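(* Let $M$ be a universal semi-POVM. Then there exist constants $c\ge 0$ and $c'>0$ such that for every density matrix $\rho\in\mathrm{Her}(N)$ and every $s\in\Sigma^*$: $$\bigl|K(s)+\log_2\operatorname{tr}(\rho M(s))\bigr|\le c,$$ and $$c'\,P(s)\le\operatorname{tr}(\rho M(s)),\qquad c'\,\operatorname{tr}(\rho M(s))\le P(s).$$
   Context: $N$ is a fixed positive integer; $\Sigma^*$ is the set of finite binary strings. $\mathrm{Her}(N)$ is the set of $N\times N$ Hermitian matrices and $\mathrm{Her}_Q(N)$ those with entries in $\{a+ib:a,b\in\mathbb{Q}\}$; $A\leqslant B$ means $B-A$ is positive semi-definite. A density matrix is $\rho\in\mathrm{Her}(N)$, $0\leqslant\rho$, $\operatorname{tr}\rho=1$. A semi-POVM on $\Sigma^*$ is a map $R:\Sigma^*\to\mathrm{Her}(N)$ with $0\leqslant R(s)$ for all $s$ and $\sum_s R(s)\leqslant I$. A lower-computable semi-POVM is a semi-POVM $R$ for which there is a total recursive $f:\mathbb{N}\times\Sigma^*\to\mathrm{Her}_Q(N)$ with $\lim_{n}f(n,s)=R(s)$ and $f(n,s)\leqslant R(s)$ for all $n,s$. A universal semi-POVM is a lower-computable semi-POVM $M$ such that for every lower-computable semi-POVM $R$ there is $c>0$ with $c\,R(s)\leqslant M(s)$ for all $s\in\Sigma^*$. A computer is a partial recursive function $C:\Sigma^*\to\Sigma^*$ with prefix-free domain; a computer $U$ is optimal if for every computer $C$ there is a constant $\mathrm{sim}(C)$ such that whenever $C(p)$ is defined there is $p'$ with $U(p')=C(p)$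 and $|p'|\le|p|+\mathrm{sim}(C)$. Fix an optimal computer $U$; $K(s)=\min\{|p|:U(p)=s\}$ and $P(s)=\sum_{U(p)=s}2^{-|p|}$. *)

theory Defs
  imports "HOL-Analysis.Analysis" "HOL-Library.Sublist" "HOL-Library.Nat_Bijection"
    "Jordan_Normal_Form.Matrix"
begin

datatype recf = Zero | Succ | Proj nat | Comp recf "recf list" | PrimRec recf recf | Minim recf

inductive evalr :: "recf \<Rightarrow> nat list \<Rightarrow> nat \<Rightarrow> bool" where
  zero: "evalr Zero xs 0"
| succ: "evalr Succ (x # xs) (Suc x)"
| proj: "i < length xs \<Longrightarrow> evalr (Proj i) xs (xs ! i)"
| comp: "list_all2 (\<lambda>g y. evalr g xs y) gs ys \<Longrightarrow> evalr f ys z \<Longrightarrow> evalr (Comp f gs) xs z"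
| pr0: "evalr f xs y \<Longrightarrow> evalr (PrimRec f g) (0 # xs) y"
| prS: "evalr (PrimRec f g) (n # xs) y \<Longrightarrow> evalr g (n # y # xs) z
         \<Longrightarrow> evalr (PrimRec f g) (Suc n # xs) z"
| mn: "evalr f (n # xs) 0 \<Longrightarrow> (\<forall>m<n. \<exists>y. evalr f (m # xs) y \<and> 0 < y)
         \<Longrightarrow> evalr (Minim f) xs n"

section \<open>Binary strings and their standard (bijective) coding by naturals\<close>

type_synonym bstring = "bool list"

fun str_code :: "bstring \<Rightarrow> nat" where
  "str_code [] = 0"
| "str_code (b # bs) = 2 * str_code bs + (if b then 2 else 1)"

text \<open>Coding of rationals by naturals (a surjection nat onto the rationals).\<close>
definition rat_code :: "nat \<Rightarrow> real" where
  "rat_code n = (let (p, d) = prod_decode n; (a, b) = prod_decode p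
                 in (real a - real b) / (real d + 1))"

definition partial_recursive_str :: "(bstring \<Rightarrow> bstring option) \<Rightarrow> bool" where
  "partial_recursive_str C \<longleftrightarrow>
     (\<exists>r. \<forall>p y. evalr r [str_code p] y \<longleftrightarrow> (\<exists>t. C p = Some t \<and> y = str_code t))"

definition computer :: "(bstring \<Rightarrow> bstring option) \<Rightarrow> bool" where
  "computer C \<longleftrightarrow> partial_recursive_str C \<and>
     (\<forall>p q. p \<in> dom C \<longrightarrow> q \<in> dom C \<longrightarrow> prefix p q \<longrightarrow> p = q)"

definition optimal_computer :: "(bstring \<Rightarrow> bstring option) \<Rightarrow> bool" where
  "optimal_computer U \<longleftrightarrow> computer U \<and>
     (\<forall>C. computer C \<longrightarrow> (\<exists>sim::nat. \<forall>p t. C p = Some t \<longrightarrow>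
         (\<exists>p'. U p' = Some t \<and> length p' \<le> length p + sim)))"

definition Kc :: "(bstring \<Rightarrow> bstring option) \<Rightarrow> bstring \<Rightarrow> nat" where
  "Kc U s = (LEAST n. \<exists>p. U p = Some s \<and> length p = n)"

definition Pc :: "(bstring \<Rightarrow> bstring option) \<Rightarrow> bstring \<Rightarrow> real" where
  "Pc U s = infsum (\<lambda>p. (1/2) ^ length p) {p. U p = Some s}"

definition hermitian :: "nat \<Rightarrow> complex mat \<Rightarrow> bool" where
  "hermitian N A \<longleftrightarrow> A \<in> carrier_mat N N \<and> (\<forall>i<N. \<forall>j<N. A $$ (i, j) = cnj (A $$ (j, i)))"

definition qform :: "nat \<Rightarrow> complex mat \<Rightarrow> (nat \<Rightarrow> complex) \<Rightarrow> complex" where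
  "qform N A v = (\<Sum>i<N. \<Sum>j<N. cnj (v i) * A $$ (i, j) * v j)"

definition psd :: "nat \<Rightarrow> complex mat \<Rightarrow> bool" where
  "psd N A \<longleftrightarrow> hermitian N A \<and> (\<forall>v. Im (qform N A v) = 0 \<and> 0 \<le> Re (qform N A v))"

definition loewner_le :: "nat \<Rightarrow> complex mat \<Rightarrow> complex mat \<Rightarrow> bool" where
  "loewner_le N A B \<longleftrightarrow> hermitian N A \<and> hermitian N B \<and> psd N (B - A)"

definition mtrace :: "complex mat \<Rightarrow> complex" where
  "mtrace A = (\<Sum>i<dim_row A. A $$ (i, i))"

definition density_matrix :: "nat \<Rightarrow> complex mat \<Rightarrow> bool" where
  "density_matrix N \<rho> \<longleftrightarrow> psd N \<rho> \<and> mtrace \<rho> = 1"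

definition msum :: "nat \<Rightarrow> ('a \<Rightarrow> complex mat) \<Rightarrow> 'a set \<Rightarrow> complex mat" where
  "msum N R S = mat N N (\<lambda>(i, j). \<Sum>s\<in>S. R s $$ (i, j))"

text \<open>For positive semi-definite summands, sum_s R(s) <= I means that all finite
  partial sums are bounded by I.\<close>
definition semi_POVM :: "nat \<Rightarrow> (bstring \<Rightarrow> complex mat) \<Rightarrow> bool" where
  "semi_POVM N R \<longleftrightarrow> (\<forall>s. psd N (R s)) \<and>
     (\<forall>S. finite S \<longrightarrow> loewner_le N (msum N R S) (1\<^sub>m N))"

definition is_rat_complex :: "complex \<Rightarrow> bool" where
  "is_rat_complex z \<longleftrightarrow> Re z \<in> \<rat> \<and> Im z \<in> \<rat>"

definition herm_Q :: "nat \<Rightarrow> complex mat \<Rightarrow> bool" where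
  "herm_Q N A \<longleftrightarrow> hermitian N A \<and> (\<forall>i<N. \<forall>j<N. is_rat_complex (A $$ (i, j)))"

definition total_recursive_HerQ :: "nat \<Rightarrow> (nat \<Rightarrow> bstring \<Rightarrow> complex mat) \<Rightarrow> bool" where
  "total_recursive_HerQ N f \<longleftrightarrow> (\<forall>n s. herm_Q N (f n s)) \<and>
     (\<exists>r. \<forall>n s i j. i < N \<longrightarrow> j < N \<longrightarrow>
        (\<exists>y z. evalr r [n, str_code s, i, j, 0] y \<and> evalr r [n, str_code s, i, j, 1] z \<and>
               f n s $$ (i, j) = Complex (rat_code y) (rat_code z)))"

definition lower_computable_semi_POVM :: "nat \<Rightarrow> (bstring \<Rightarrow> complex mat) \<Rightarrow> bool" where
  "lower_computable_semi_POVM N R \<longleftrightarrow> semi_POVM N R \<and>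
     (\<exists>f. total_recursive_HerQ N f \<and>
        (\<forall>s. \<forall>i<N. \<forall>j<N. (\<lambda>n. f n s $$ (i, j)) \<longlonglongrightarrow> R s $$ (i, j)) \<and>
        (\<forall>n s. loewner_le N (f n s) (R s)))"

definition universal_semi_POVM :: "nat \<Rightarrow> (bstring \<Rightarrow> complex mat) \<Rightarrow> bool" where
  "universal_semi_POVM N M \<longleftrightarrow> lower_computable_semi_POVM N M \<and>
     (\<forall>R. lower_computable_semi_POVM N R \<longrightarrow>
        (\<exists>c>0. \<forall>s. loewner_le N (complex_of_real c \<cdot>\<^sub>m R s) (M s)))"

end

theory Submission
  imports Defs
begin

text \<open>
  Two comparisons sandwich \<open>tr (\<rho> M(s))\<close>. From below, \<open>P(s) I\<close> is a lower-computable
  semi-POVM: running the optimal computer with bounded resources enumerates its halting programs,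
  and Kraft's inequality bounds the total mass. Universality gives \<open>a P(s) I \<le> M(s)\<close>, hence
  \<open>a P(s) \<le> tr (\<rho> M(s))\<close>. From above, \<open>tr (\<rho> M(s)) \<le> N\<^sup>2 tr M(s)\<close>, and every diagonal entry of
  \<open>M\<close> is a lower-computable semimeasure, so Levin's coding theorem bounds it by a multiple of
  \<open>2\<close> to the power \<open>-K(s)\<close>, which is at most \<open>P(s)\<close>.
\<close>

section \<open>Total recursive functions\<close>

text \<open>The density matrix is arbitrary and may have uncomputable entries, so
  \<open>tr (\<rho> M(s))\<close> need not be lower computable as a function of \<open>s\<close>,
  and the coding theorem cannot be applied to it directly. Passing to \<open>tr M(s)\<close> removes
  \<open>\<rho>\<close> and makes the constants uniform in it. With \<open>2\<close> to the power
  \<open>-K(s)\<close> at most \<open>P(s)\<close>, the two comparisons close up into the single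
  chain \<open>a 2^-K <= a P <= t <= B 2^-K <= B P\<close>, where \<open>t\<close> is the trace. All
  claimed bounds are read off from it.

  Recursiveness means that a term of type \<open>recf\<close> exists, so each algorithm has to be
  phrased in arithmetic. Bounded searches become finite sums of indicators, and the halting of a
  program becomes a total function by cutting its searches off. In the coding theorem no free space
  has to be managed: intervals are laid end to end in the order of the requests, and since a
  request's position depends only on smaller requests it is computable. The price is a bounded
  number of extra bits, absorbed by the constants.\<close>

definition total_rec :: "nat \<Rightarrow> (nat list \<Rightarrow> nat) \<Rightarrow> bool" where
  "total_rec n f \<longleftrightarrow> (\<exists>r. \<forall>xs. length xs = n \<longrightarrow> evalr r xs (f xs))"

lemma total_rec_cong:
  assumes "total_rec n f" "\<And>xs. length xs = n \<Longrightarrow> f xs = g xs"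
  shows "total_rec n g"
  using assms unfolding total_rec_def by metis

lemma total_rec_nth: "i < n \<Longrightarrow> total_rec n (\<lambda>xs. xs ! i)"
  unfolding total_rec_def by (metis evalr.proj)

lemma total_rec_comp:
  assumes f: "total_rec (length gs) f" and gs: "\<And>g. g \<in> set gs \<Longrightarrow> total_rec n g"
  shows "total_rec n (\<lambda>xs. f (map (\<lambda>g. g xs) gs))"
proof -
  obtain rf where rf: "\<And>ys. length ys = length gs \<Longrightarrow> evalr rf ys (f ys)"
    using f unfolding total_rec_def by blast
  obtain R where R: "\<And>g xs. g \<in> set gs \<Longrightarrow> length xs = n \<Longrightarrow> evalr (R g) xs (g xs)"
    using gs unfolding total_rec_def by metis
  have "evalr (Comp rf (map R gs)) xs (f (map (\<lambda>g. g xs) gs))" if "length xs = n" for xs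
  proof (rule evalr.comp)
    show "list_all2 (\<lambda>g y. evalr g xs y) (map R gs) (map (\<lambda>g. g xs) gs)"
      using R that by (auto simp: list_all2_conv_all_nth)
    show "evalr rf (map (\<lambda>g. g xs) gs) (f (map (\<lambda>g. g xs) gs))"
      by (rule rf) simp
  qed
  then show ?thesis unfolding total_rec_def by blast
qed

lemma total_rec_app1:
  assumes "total_rec 1 (\<lambda>xs. h (xs ! 0))" "total_rec n a"
  shows "total_rec n (\<lambda>xs. h (a xs))"
  using total_rec_comp[of "[a]" "\<lambda>xs. h (xs ! 0)" n] assms by simp

lemma total_rec_app2:
  assumes "total_rec 2 (\<lambda>xs. h (xs ! 0) (xs ! 1))" "total_rec n a" "total_rec n b"
  shows "total_rec n (\<lambda>xs. h (a xs) (b xs))"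
proof -
  have "total_rec n (\<lambda>xs. h (map (\<lambda>g. g xs) [a, b] ! 0) (map (\<lambda>g. g xs) [a, b] ! 1))"
    by (rule total_rec_comp[where f = "\<lambda>xs. h (xs ! 0) (xs ! 1)"])
       (use assms in \<open>auto simp: numeral_2_eq_2[symmetric]\<close>)
  then show ?thesis by simp
qed

text \<open>This feeds a rearranged or extended argument list to a recursive function: only the
  single entries of the new list have to be recursive, since the list can be rebuilt from its
  entries and composed by \<open>total_rec_comp\<close>.\<close>

lemma total_rec_app_list:
  assumes f: "total_rec m f" and len: "\<And>xs. length xs = n \<Longrightarrow> length (F xs) = m"
    and F: "\<And>i. i < m \<Longrightarrow> total_rec n (\<lambda>xs. F xs ! i)"
  shows "total_rec n (\<lambda>xs. f (F xs))"
proof -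
  have "total_rec n (\<lambda>xs. f (map (\<lambda>g. g xs) (map (\<lambda>i xs. F xs ! i) [0..<m])))"
    by (rule total_rec_comp) (use f F in auto)
  then show ?thesis
  proof (rule total_rec_cong)
    fix xs :: "nat list" assume "length xs = n"
    then have "map (\<lambda>g. g xs) (map (\<lambda>i xs. F xs ! i) [0..<m]) = F xs"
      by (auto intro!: nth_equalityI simp: len)
    then show "f (map (\<lambda>g. g xs) (map (\<lambda>i xs. F xs ! i) [0..<m])) = f (F xs)" by simp
  qed
qed

lemma total_rec_tl:
  assumes "total_rec n f"
  shows "total_rec (Suc n) (\<lambda>ys. f (tl ys))"
proof (rule total_rec_app_list[OF assms])
  fix i assume "i < n"
  then show "total_rec (Suc n) (\<lambda>xs. tl xs ! i)"
    by (intro total_rec_cong[OF total_rec_nth[of "Suc i"]]) (auto simp: nth_tl)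
qed simp

lemma total_rec_Suc:
  assumes "total_rec n a" shows "total_rec n (\<lambda>xs. Suc (a xs))"
proof (rule total_rec_app1[OF _ assms])
  have "evalr Succ xs (Suc (xs ! 0))" if "length xs = 1" for xs
    using that by (cases xs) (auto intro: evalr.succ)
  then show "total_rec 1 (\<lambda>xs. Suc (xs ! 0))"
    unfolding total_rec_def by blast
qed

lemma total_rec_const: "total_rec n (\<lambda>xs. c)"
proof (induction c)
  case 0
  show ?case unfolding total_rec_def by (metis evalr.zero)
next
  case (Suc c)
  show ?case by (rule total_rec_Suc[OF Suc])
qed

text \<open>\<open>PrimRec\<close> passes the counter and the previous value ahead of the
  parameters, which is why the parameters appear as \<open>tl (tl ys)\<close> in the premise on
  \<open>g\<close>.\<close>

lemma total_rec_rec_nat: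
  assumes a: "total_rec n a" and g: "total_rec (Suc (Suc n)) (\<lambda>ys. g (tl (tl ys)) (ys ! 0) (ys ! 1))"
    and t: "total_rec n t"
  shows "total_rec n (\<lambda>xs. rec_nat (a xs) (g xs) (t xs))"
proof -
  obtain ra where ra: "\<And>xs. length xs = n \<Longrightarrow> evalr ra xs (a xs)"
    using a unfolding total_rec_def by blast
  obtain rg where rg: "\<And>xs. length xs = Suc (Suc n) \<Longrightarrow> evalr rg xs (g (tl (tl xs)) (xs ! 0) (xs ! 1))"
    using g unfolding total_rec_def by blast
  have step: "evalr (PrimRec ra rg) (k # xs) (rec_nat (a xs) (g xs) k)" if "length xs = n" for xs k
  proof (induction k)
    case 0
    show ?case using ra[OF that] by (auto intro: evalr.pr0)
  next
    case (Suc k)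
    show ?case
      using evalr.prS[OF Suc, of "g xs k (rec_nat (a xs) (g xs) k)"]
        rg[of "k # rec_nat (a xs) (g xs) k # xs"] that by simp
  qed
  then have "evalr (PrimRec ra rg) ys (rec_nat (a (tl ys)) (g (tl ys)) (hd ys))"
    if "length ys = Suc n" for ys
    using that by (cases ys) auto
  then have "total_rec (Suc n) (\<lambda>ys. rec_nat (a (tl ys)) (g (tl ys)) (hd ys))"
    unfolding total_rec_def by blast
  then have "total_rec n (\<lambda>xs. rec_nat (a (tl (t xs # xs))) (g (tl (t xs # xs))) (hd (t xs # xs)))"
  proof (rule total_rec_app_list)
    fix i assume "i < Suc n"
    then show "total_rec n (\<lambda>xs. (t xs # xs) ! i)"
      using t by (cases i) (auto intro: total_rec_nth)
  qed simp
  then show ?thesis by simp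
qed

lemma total_rec_shift2:
  assumes "total_rec n a"
  shows "total_rec (Suc (Suc n)) (\<lambda>ys. a (tl (tl ys)))"
  using total_rec_tl[OF total_rec_tl[OF assms]] .

section \<open>Arithmetic, decidable relations and bounded searches\<close>

lemma total_rec_add:
  assumes "total_rec n a" "total_rec n b"
  shows "total_rec n (\<lambda>xs. a xs + b xs)"
proof -
  have "total_rec n (\<lambda>xs. rec_nat (a xs) (\<lambda>k y. Suc y) (b xs))"
    by (intro total_rec_rec_nat assms total_rec_Suc total_rec_nth) simp
  moreover have "rec_nat x (\<lambda>k y. Suc y) y = x + y" for x y :: nat by (induction y) auto
  ultimately show ?thesis by simp
qed

lemma total_rec_mult:
  assumes "total_rec n a" "total_rec n b"
  shows "total_rec n (\<lambda>xs. a xs * b xs)"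
proof -
  have "total_rec n (\<lambda>xs. rec_nat 0 (\<lambda>k y. y + a xs) (b xs))"
    by (intro total_rec_rec_nat assms total_rec_const total_rec_nth total_rec_add
        total_rec_shift2) auto
  moreover have "rec_nat 0 (\<lambda>k y. y + x) y = x * y" for x y :: nat by (induction y) auto
  ultimately show ?thesis by simp
qed

lemma total_rec_power:
  assumes "total_rec n a" "total_rec n b"
  shows "total_rec n (\<lambda>xs. a xs ^ b xs)"
proof -
  have "total_rec n (\<lambda>xs. rec_nat 1 (\<lambda>k y. y * a xs) (b xs))"
    by (intro total_rec_rec_nat assms total_rec_const total_rec_nth total_rec_mult
        total_rec_shift2) auto
  moreover have "rec_nat 1 (\<lambda>k y. y * x) y = x ^ y" for x y :: nat by (induction y) auto
  ultimately show ?thesis by simp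
qed

lemma total_rec_diff:
  assumes "total_rec n a" "total_rec n b"
  shows "total_rec n (\<lambda>xs. a xs - b xs)"
proof -
  have "total_rec 1 (\<lambda>xs. rec_nat 0 (\<lambda>k y. k) (xs ! 0))"
    by (intro total_rec_rec_nat total_rec_const total_rec_nth) auto
  moreover have "rec_nat 0 (\<lambda>k y. k) x = x - 1" for x :: nat by (cases x) auto
  ultimately have pred: "total_rec 1 (\<lambda>xs. xs ! 0 - 1)" by simp
  have "total_rec n (\<lambda>xs. rec_nat (a xs) (\<lambda>k y. y - 1) (b xs))"
    by (intro total_rec_rec_nat assms total_rec_app1[OF pred] total_rec_nth) auto
  moreover have "rec_nat x (\<lambda>k y. y - 1) y = x - y" for x y :: nat by (induction y) auto
  ultimately show ?thesis by simp
qed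

definition decidable_rec :: "nat \<Rightarrow> (nat list \<Rightarrow> bool) \<Rightarrow> bool" where
  "decidable_rec n P \<longleftrightarrow> total_rec n (\<lambda>xs. of_bool (P xs))"

lemma total_rec_if:
  assumes "decidable_rec n P" "total_rec n a" "total_rec n b"
  shows "total_rec n (\<lambda>xs. if P xs then a xs else b xs)"
proof -
  have "total_rec n (\<lambda>xs. of_bool (P xs) * a xs + (1 - of_bool (P xs)) * b xs)"
    by (intro total_rec_add total_rec_mult total_rec_diff total_rec_const
        assms(2,3) assms(1)[unfolded decidable_rec_def])
  then show ?thesis by (rule total_rec_cong) auto
qed

lemma decidable_rec_not:
  assumes "decidable_rec n P" shows "decidable_rec n (\<lambda>xs. \<not> P xs)"
proof -
  have "total_rec n (\<lambda>xs. 1 - of_bool (P xs))"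
    by (intro total_rec_diff total_rec_const assms[unfolded decidable_rec_def])
  then show ?thesis unfolding decidable_rec_def by (rule total_rec_cong) auto
qed

lemma decidable_rec_conj:
  assumes "decidable_rec n P" "decidable_rec n Q"
  shows "decidable_rec n (\<lambda>xs. P xs \<and> Q xs)"
proof -
  have "total_rec n (\<lambda>xs. of_bool (P xs) * of_bool (Q xs))"
    by (intro total_rec_mult assms[unfolded decidable_rec_def])
  then show ?thesis unfolding decidable_rec_def by (rule total_rec_cong) auto
qed

lemma decidable_rec_le:
  assumes "total_rec n a" "total_rec n b"
  shows "decidable_rec n (\<lambda>xs. a xs \<le> b xs)"
proof -
  have "total_rec n (\<lambda>xs. 1 - (a xs - b xs))"
    by (intro total_rec_diff total_rec_const assms)
  then show ?thesis unfolding decidable_rec_def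
    by (rule total_rec_cong) auto
qed

lemma decidable_rec_less:
  assumes "total_rec n a" "total_rec n b"
  shows "decidable_rec n (\<lambda>xs. a xs < b xs)"
  using decidable_rec_le[OF total_rec_Suc[OF assms(1)] assms(2)] by (simp add: Suc_le_eq)

lemma decidable_rec_eq:
  assumes "total_rec n a" "total_rec n b"
  shows "decidable_rec n (\<lambda>xs. a xs = b xs)"
proof -
  have "decidable_rec n (\<lambda>xs. a xs \<le> b xs \<and> b xs \<le> a xs)"
    by (intro decidable_rec_conj decidable_rec_le assms)
  then show ?thesis by (simp only: order_eq_iff[symmetric])
qed

lemma total_rec_sum:
  assumes g: "total_rec (Suc n) (\<lambda>ys. g (tl ys) (ys ! 0))" and t: "total_rec n t"
  shows "total_rec n (\<lambda>xs. \<Sum>k<t xs. g xs k)"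
proof -
  have "total_rec (Suc (Suc n)) (\<lambda>ys. g (tl (ys ! 0 # tl (tl ys))) ((ys ! 0 # tl (tl ys)) ! 0))"
  proof (rule total_rec_app_list[OF g])
    fix i assume "i < Suc n"
    then show "total_rec (Suc (Suc n)) (\<lambda>xs. (xs ! 0 # tl (tl xs)) ! i)"
      by (cases i) (auto intro!: total_rec_nth total_rec_shift2[of n "\<lambda>xs. xs ! _"])
  qed simp
  then have "total_rec n (\<lambda>xs. rec_nat 0 (\<lambda>k y. y + g xs k) (t xs))"
    by (intro total_rec_rec_nat total_rec_const total_rec_add total_rec_nth t) simp_all
  moreover have "rec_nat 0 (\<lambda>k y. y + h k) m = sum h {..<m}" for h :: "nat \<Rightarrow> nat" and m
    by (induction m) auto
  ultimately show ?thesis by simp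
qed

text \<open>The quantifier holds exactly if the number of counterexamples below the bound is zero,
  and that number is a bounded sum.\<close>

lemma decidable_rec_all_less:
  assumes g: "decidable_rec (Suc n) (\<lambda>ys. P (tl ys) (ys ! 0))" and t: "total_rec n t"
  shows "decidable_rec n (\<lambda>xs. \<forall>k<t xs. P xs k)"
proof -
  have "decidable_rec n (\<lambda>xs. (\<Sum>k<t xs. of_bool (\<not> P xs k)) = (0::nat))"
    by (intro decidable_rec_eq total_rec_sum total_rec_const t
        decidable_rec_not[OF g, unfolded decidable_rec_def])
  moreover have "(\<Sum>k<m. of_bool (\<not> p k)) = (0::nat) \<longleftrightarrow> (\<forall>k<m. p k)" for p and m :: nat
    by (subst sum_eq_0_iff) auto
  ultimately show ?thesis by simp
qed

text \<open>The quotient of \<open>x\<close> counts the \<open>k\<close> whose successor, times the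
  divisor, still fits into \<open>x\<close>. Searching below \<open>x\<close> suffices because the
  quotient is at most \<open>x\<close>.\<close>

lemma total_rec_div2_power:
  assumes "total_rec n a" "total_rec n b"
  shows "total_rec n (\<lambda>xs. a xs div 2 ^ b xs)"
proof -
  have "total_rec 2 (\<lambda>xs. \<Sum>k<xs!0. if Suc k * 2 ^ (xs!1) \<le> xs!0 then 1 else 0)"
    by (intro total_rec_sum total_rec_if decidable_rec_le total_rec_mult total_rec_power total_rec_Suc
        total_rec_const total_rec_nth total_rec_tl[of 2 "\<lambda>xs. xs ! _"]) auto
  moreover have "(\<Sum>k<x. if Suc k * 2 ^ y \<le> x then 1 else 0) = x div 2 ^ y" for x y :: nat
  proof -
    have "(\<Sum>k<x. if Suc k * 2 ^ y \<le> x then 1 else 0) = card {k \<in> {..<x}. Suc k * 2 ^ y \<le> x}"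
      by (simp add: sum.inter_filter[symmetric])
    also have "{k \<in> {..<x}. Suc k * 2 ^ y \<le> x} = {..< x div 2 ^ y}"
    proof -
      have "Suc k * 2 ^ y \<le> x \<longleftrightarrow> k < x div 2 ^ y" for k
        using less_eq_div_iff_mult_less_eq[of "2 ^ y" "Suc k" x] by (simp add: Suc_le_eq)
      moreover have "k < x" if "k < x div 2 ^ y" for k
        using that div_le_dividend[of x "2 ^ y"] by linarith
      ultimately show ?thesis by blast
    qed
    finally show ?thesis by simp
  qed
  ultimately have "total_rec 2 (\<lambda>xs. (xs!0) div 2 ^ (xs!1))" by simp
  from total_rec_app2[OF this assms] show ?thesis .
qed

lemma decidable_rec_odd:
  assumes "total_rec n a" shows "decidable_rec n (\<lambda>xs. odd (a xs))"
proof -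
  have "decidable_rec n (\<lambda>xs. 2 * (a xs div 2 ^ 1) < a xs)"
    by (intro decidable_rec_less total_rec_mult total_rec_const total_rec_div2_power assms)
  moreover have "2 * (x div 2 ^ 1) < x \<longleftrightarrow> odd x" for x :: nat
    by simp presburger
  ultimately show ?thesis by simp
qed

lemma total_rec_prod_encode:
  assumes "total_rec n a" "total_rec n b"
  shows "total_rec n (\<lambda>xs. prod_encode (a xs, b xs))"
proof -
  have "total_rec n (\<lambda>xs. (((a xs + b xs) * Suc (a xs + b xs)) div 2 ^ 1) + a xs)"
    by (intro total_rec_add total_rec_div2_power total_rec_mult total_rec_Suc total_rec_const assms)
  then show ?thesis by (simp add: prod_encode_def triangle_def)
qed

text \<open>The pairing function is inverted by exhaustive search: both components are at most the
  code, and injectivity leaves one nonzero candidate in the double sum, which is therefore the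
  component sought.\<close>

lemma total_rec_prod_decode:
  assumes "total_rec n a"
  shows "total_rec n (\<lambda>xs. fst (prod_decode (a xs)))" "total_rec n (\<lambda>xs. snd (prod_decode (a xs)))"
proof -
  have eq: "(\<Sum>x<Suc z. \<Sum>y<Suc z. if prod_encode (x, y) = z then h x y else 0) =
      h (fst (prod_decode z)) (snd (prod_decode z))" for z and h :: "nat \<Rightarrow> nat \<Rightarrow> nat"
  proof -
    obtain u v where uv: "prod_decode z = (u, v)" by fastforce
    then have z: "prod_encode (u, v) = z" by (metis prod_decode_inverse)
    then have le: "u < Suc z" "v < Suc z"
      using le_prod_encode_1[of u v] le_prod_encode_2[of v u] by auto
    have iff: "prod_encode (x, y) = z \<longleftrightarrow> x = u \<and> y = v" for x y
      using z by (metis prod.inject prod_encode_eq)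
    have "(\<Sum>x<Suc z. \<Sum>y<Suc z. if prod_encode (x, y) = z then h x y else 0)
        = (\<Sum>x<Suc z. if x = u then (\<Sum>y<Suc z. if y = v then h x y else 0) else 0)"
      unfolding iff by (intro sum.cong) auto
    also have "\<dots> = h u v" using le by (simp del: sum.lessThan_Suc)
    finally show ?thesis using uv by simp
  qed
  have nth: "total_rec (Suc (Suc 1)) (\<lambda>ys. ys ! 0)" "total_rec (Suc (Suc 1)) (\<lambda>ys. tl ys ! 0)"
       "total_rec (Suc (Suc 1)) (\<lambda>ys. tl (tl ys) ! 0)" "total_rec (Suc 1) (\<lambda>ys. tl ys ! 0)"
       "total_rec 1 (\<lambda>ys. ys ! 0)"
    by (intro total_rec_nth total_rec_tl[of _ "\<lambda>xs. xs ! _"]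
        total_rec_shift2[of _ "\<lambda>xs. xs ! _"]; simp)+
  have "total_rec 1 (\<lambda>xs. \<Sum>x<Suc (xs!0). \<Sum>y<Suc (xs!0). if prod_encode (x, y) = xs!0 then x else 0)"
       "total_rec 1 (\<lambda>xs. \<Sum>x<Suc (xs!0). \<Sum>y<Suc (xs!0). if prod_encode (x, y) = xs!0 then y else 0)"
    by (intro total_rec_sum total_rec_if decidable_rec_eq total_rec_prod_encode total_rec_Suc
        total_rec_const nth)+
  note * = this[unfolded eq]
  show "total_rec n (\<lambda>xs. fst (prod_decode (a xs)))" "total_rec n (\<lambda>xs. snd (prod_decode (a xs)))"
    using total_rec_app1[OF *(1) assms] total_rec_app1[OF *(2) assms] by auto
qed

section \<open>Bounded evaluation and enumeration\<close>

text \<open>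
  Evaluation in which every unbounded search is cut off at \<open>t\<close>. The result \<open>0\<close> means that no
  value was found, and \<open>Suc y\<close> stands for the value \<open>y\<close>.
\<close>

primrec step_eval :: "recf \<Rightarrow> nat \<Rightarrow> nat list \<Rightarrow> nat" where
  "step_eval Zero t xs = 1"
| "step_eval Succ t xs = (case xs of [] \<Rightarrow> 0 | x # _ \<Rightarrow> Suc (Suc x))"
| "step_eval (Proj i) t xs = (if i < length xs then Suc (xs ! i) else 0)"
| "step_eval (Comp f gs) t xs =
    (let ys = map (\<lambda>h. h t xs) (map step_eval gs)
     in if \<forall>y\<in>set ys. 0 < y then step_eval f t (map (\<lambda>y. y - 1) ys) else 0)"
| "step_eval (PrimRec f g) t xs =
    (case xs of [] \<Rightarrow> 0
     | n # zs \<Rightarrow> rec_nat (step_eval f t zs)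
                   (\<lambda>k y. if 0 < y then step_eval g t (k # (y - 1) # zs) else 0) n)"
| "step_eval (Minim f) t xs =
    (\<Sum>n<t. if step_eval f t (n # xs) = 1 \<and> (\<forall>m<n. 1 < step_eval f t (m # xs)) then Suc n else 0)"

lemma step_eval_sound: "step_eval r t xs = Suc y \<Longrightarrow> evalr r xs y"
proof (induction r arbitrary: xs y)
  case Zero
  then show ?case by (auto intro: evalr.zero)
next
  case Succ
  then show ?case by (auto split: list.splits intro: evalr.succ)
next
  case (Proj i)
  then show ?case by (auto split: if_splits intro: evalr.proj)
next
  case (Comp f gs)
  let ?ys = "map (\<lambda>g. step_eval g t xs) gs"
  have pos: "\<forall>g\<in>set gs. 0 < step_eval g t xs" and f: "step_eval f t (map (\<lambda>y. y - 1) ?ys) = Suc y"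
    using Comp.prems by (auto simp: Let_def o_def split: if_splits)
  show ?case
  proof (rule evalr.comp)
    show "list_all2 (\<lambda>g y. evalr g xs y) gs (map (\<lambda>y. y - 1) ?ys)"
      using Comp.IH(2) pos by (auto simp: list_all2_conv_all_nth)
    show "evalr f (map (\<lambda>y. y - 1) ?ys) y"
      using Comp.IH(1) f by blast
  qed
next
  case (PrimRec f g)
  obtain n zs where xs: "xs = n # zs"
    using PrimRec.prems by (cases xs) auto
  have "rec_nat (step_eval f t zs) (\<lambda>k y. if 0 < y then step_eval g t (k # (y - 1) # zs) else 0) n = Suc y
     \<Longrightarrow> evalr (PrimRec f g) (n # zs) y"
  proof (induction n arbitrary: y)
    case 0
    then show ?case using PrimRec.IH(1) by (auto intro: evalr.pr0)
  next
    case (Suc n)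
    then show ?case
      using PrimRec.IH(2) by (auto split: if_splits simp: gr0_conv_Suc intro: evalr.prS)
  qed
  then show ?case using PrimRec.prems xs by simp
next
  case (Minim f)
  have "\<exists>n<t. step_eval f t (n # xs) = 1 \<and> (\<forall>m<n. 1 < step_eval f t (m # xs))"
  proof (rule ccontr)
    assume "\<not> ?thesis"
    then have "step_eval (Minim f) t xs = 0" by (auto intro!: sum.neutral)
    then show False using Minim.prems by simp
  qed
  then obtain n where n: "n < t" "step_eval f t (n # xs) = 1" "\<forall>m<n. 1 < step_eval f t (m # xs)"
    by blast
  \<comment> \<open>Result \<open>1\<close> codes the value \<open>0\<close> and a larger result
    codes a positive value, so at most one \<open>k\<close> can be the first zero. The sum defining
    \<open>step_eval\<close> of \<open>Minim\<close> collapses to that summand.\<close>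
  have uniq: "(step_eval f t (k # xs) = 1 \<and> (\<forall>m<k. 1 < step_eval f t (m # xs))) = (k = n)" for k
    using n(2,3) by (metis less_irrefl linorder_neqE_nat)
  have "y = n"
    using Minim.prems n(1) unfolding step_eval.simps uniq by simp
  have "evalr (Minim f) xs n"
  proof (rule evalr.mn)
    show "evalr f (n # xs) 0" using n(2) Minim.IH[of "n # xs" 0] by simp
    show "\<forall>m<n. \<exists>y. evalr f (m # xs) y \<and> 0 < y"
    proof (intro allI impI)
      fix m assume "m < n"
      then have "step_eval f t (m # xs) = Suc (step_eval f t (m # xs) - 1)"
        "0 < step_eval f t (m # xs) - 1" using n(3) by auto
      then show "\<exists>y. evalr f (m # xs) y \<and> 0 < y" using Minim.IH by blast
    qed
  qed
  then show ?case using \<open>y = n\<close> by simp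
qed

text \<open>Quantifying the bound by \<open>eventually\<close> makes finitely many requirements on
  it compatible: those of the arguments of \<open>Comp\<close>, and those of the failed trials of
  \<open>Minim\<close>.\<close>

lemma step_eval_complete: "evalr r xs y \<Longrightarrow> \<forall>\<^sub>F t in sequentially. step_eval r t xs = Suc y"
proof (induction rule: evalr.induct)
  case (comp xs gs ys f z)
  have "\<forall>\<^sub>F t in sequentially. \<forall>i\<in>{..<length gs}. step_eval (gs ! i) t xs = Suc (ys ! i)"
    by (rule eventually_ball_finite) (use comp.IH(1) in \<open>auto simp: list_all2_conv_all_nth\<close>)
  with comp.IH(2) show ?case
  proof eventually_elim
    case (elim t)
    have len: "length gs = length ys" using comp.IH(1) by (auto dest: list_all2_lengthD)
    have "map (\<lambda>g. step_eval g t xs) gs = map Suc ys"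
      by (rule nth_equalityI) (use elim(2) len in auto)
    then show ?case using elim(1) by (simp add: Let_def o_def)
  qed
next
  case (prS f g n xs y z)
  from prS.IH show ?case
    by eventually_elim simp
next
  case (mn f n xs)
  from mn.IH(2) obtain Y where
    Y: "\<And>m. m < n \<Longrightarrow> 0 < Y m \<and> (\<forall>\<^sub>F t in sequentially. step_eval f t (m # xs) = Suc (Y m))"
    by metis
  then have "\<forall>\<^sub>F t in sequentially. \<forall>m\<in>{..<n}. step_eval f t (m # xs) = Suc (Y m)"
    by (intro eventually_ball_finite) auto
  with mn.IH(1) eventually_gt_at_top[of n] show ?case
  proof eventually_elim
    case (elim t)
    have pos: "\<forall>m<n. 1 < step_eval f t (m # xs)" using elim(3) Y by auto
    have uniq: "(step_eval f t (k # xs) = 1 \<and> (\<forall>m<k. 1 < step_eval f t (m # xs))) = (k = n)" for k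
      using elim(1) pos by (metis One_nat_def less_irrefl linorder_neqE_nat)
    show ?case using elim(2) unfolding step_eval.simps uniq by simp
  qed
qed (auto simp: list_all2_conv_all_nth)

text \<open>Both values are found at a common large bound, where \<open>step_eval\<close> has only
  one result. \<open>total_rec\<close> asserts only that the right value is reached; this lemma
  excludes any other.\<close>

lemma evalr_functional:
  assumes "evalr r xs y" "evalr r xs z"
  shows "y = z"
proof -
  have "\<forall>\<^sub>F t in sequentially. step_eval r t xs = Suc y \<and> step_eval r t xs = Suc z"
    using assms by (intro eventually_conj step_eval_complete)
  then show ?thesis
    by (auto dest: eventually_happens'[OF sequentially_bot])
qed

lemma decidable_rec_ball:
  assumes "finite I" "\<And>i. i \<in> I \<Longrightarrow> decidable_rec n (P i)"
  shows "decidable_rec n (\<lambda>xs. \<forall>i\<in>I. P i xs)"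
  using assms
proof (induction I rule: finite_induct)
  case empty
  show ?case by (simp add: decidable_rec_def total_rec_const)
next
  case (insert i I)
  then show ?case using decidable_rec_conj[of n "P i" "\<lambda>xs. \<forall>i\<in>I. P i xs"] by simp
qed

lemma total_rec_nth_Cons:
  assumes "total_rec n a" "\<And>j. j < m \<Longrightarrow> total_rec n (\<lambda>ys. F ys ! j)" "i < Suc m"
  shows "total_rec n (\<lambda>ys. (a ys # F ys) ! i)"
  using assms by (cases i) auto

text \<open>The program \<open>r\<close> is fixed and only the bound and the arguments vary, so
  induction on \<open>r\<close> replaces the construction of a universal function.\<close>

lemma total_rec_step_eval: "total_rec (Suc n) (\<lambda>ys. step_eval r (ys ! 0) (tl ys))"
proof (induction r arbitrary: n)
  case Zero
  show ?case by (simp add: total_rec_const)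
next
  case Succ
  show ?case
  proof (cases n)
    case 0
    show ?thesis
      by (rule total_rec_cong[OF total_rec_const[of _ 0]]) (auto simp: 0 length_Suc_conv)
  next
    case (Suc m)
    have "total_rec (Suc n) (\<lambda>ys. Suc (Suc (ys ! 1)))"
      by (intro total_rec_Suc total_rec_nth) (simp add: Suc)
    then show ?thesis
      by (rule total_rec_cong) (auto simp: Suc length_Suc_conv)
  qed
next
  case (Proj i)
  show ?case
  proof (cases "i < n")
    case True
    have "total_rec (Suc n) (\<lambda>ys. Suc (tl ys ! i))"
      by (intro total_rec_Suc total_rec_tl[of _ "\<lambda>xs. xs ! _"] total_rec_nth True)
    then show ?thesis by (rule total_rec_cong) (simp add: True)
  next
    case False
    then show ?thesis by (intro total_rec_cong[OF total_rec_const[of _ 0]]) simp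
  qed
next
  case (Comp f gs)
  let ?v = "\<lambda>i ys. step_eval (gs ! i) (ys ! 0) (tl ys)"
  have v: "total_rec (Suc n) (?v i)" if "i < length gs" for i
    using Comp.IH(2)[of "gs ! i" n] that by simp
  let ?F = "\<lambda>ys. (ys ! 0) # map (\<lambda>i. ?v i ys - 1) [0..<length gs]"
  have "total_rec (Suc n) (\<lambda>ys. step_eval f (?F ys ! 0) (tl (?F ys)))"
  proof (rule total_rec_app_list[OF Comp.IH(1)[of "length gs"]])
    fix i assume "i < Suc (length gs)"
    then show "total_rec (Suc n) (\<lambda>ys. ?F ys ! i)"
      by (cases i) (auto intro!: total_rec_nth total_rec_diff total_rec_const v)
  qed simp
  then have "total_rec (Suc n) (\<lambda>ys. if \<forall>i\<in>{..<length gs}. 0 < ?v i ys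
      then step_eval f (ys ! 0) (map (\<lambda>i. ?v i ys - 1) [0..<length gs]) else 0)"
    by (intro total_rec_if decidable_rec_ball decidable_rec_less total_rec_const) (auto intro: v)
  then show ?case
  proof (rule total_rec_cong)
    fix ys :: "nat list"
    have "map (\<lambda>i. ?v i ys - 1) [0..<length gs] = map (\<lambda>g. step_eval g (ys ! 0) (tl ys) - 1) gs"
      by (rule nth_equalityI) auto
    moreover have "(\<forall>i\<in>{..<length gs}. 0 < ?v i ys) = (\<forall>g\<in>set gs. 0 < step_eval g (ys ! 0) (tl ys))"
      by (auto simp: all_set_conv_all_nth)
    ultimately show "(if \<forall>i\<in>{..<length gs}. 0 < ?v i ys
      then step_eval f (ys ! 0) (map (\<lambda>i. ?v i ys - 1) [0..<length gs]) else 0) =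
      step_eval (Comp f gs) (ys ! 0) (tl ys)"
      by (auto simp: Let_def o_def)
  qed
next
  case (PrimRec f g)
  show ?case
  proof (cases n)
    case 0
    show ?thesis
      by (rule total_rec_cong[OF total_rec_const[of _ 0]]) (auto simp: 0 length_Suc_conv)
  next
    case (Suc m)
    let ?A = "\<lambda>ys::nat list. (ys ! 0) # tl (tl ys)"
    have A: "total_rec (Suc n) (\<lambda>ys. step_eval f (?A ys ! 0) (tl (?A ys)))"
    proof (rule total_rec_app_list[OF PrimRec.IH(1)[of m]])
      fix i assume "i < Suc m"
      then show "total_rec (Suc n) (\<lambda>ys. ?A ys ! i)"
        by (cases i) (auto simp: Suc intro!: total_rec_nth total_rec_shift2[of m "\<lambda>xs. xs ! _"])
    qed (simp add: Suc)
    \<comment> \<open>In the recursion step \<open>ys\<close> lists the counter, the previous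
      result, the bound, the recursion argument and then the parameters. Hence the bound is
      \<open>ys ! 2\<close>, and four tails lead to the parameters. The \<open>- 1\<close> undoes
      the successor that marks a result as found.\<close>
    let ?B = "\<lambda>ys::nat list. (ys ! 2) # (ys ! 0) # (ys ! 1 - 1) # tl (tl (tl (tl ys)))"
    have B: "total_rec (Suc (Suc (Suc n))) (\<lambda>ys. step_eval g (?B ys ! 0) (tl (?B ys)))"
    proof (rule total_rec_app_list[OF PrimRec.IH(2)[of "Suc (Suc m)"]])
      fix i assume i: "i < Suc (Suc (Suc m))"
      have t: "total_rec (Suc (Suc (Suc (Suc m)))) (\<lambda>xs. tl (tl (tl (tl xs))) ! j)" if "j < m" for j
        by (intro total_rec_shift2[of _ "\<lambda>xs. tl (tl xs) ! j"]
            total_rec_shift2[of _ "\<lambda>xs. xs ! j"] total_rec_nth that)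
      show "total_rec (Suc (Suc (Suc n))) (\<lambda>ys. ?B ys ! i)"
        unfolding Suc by (intro total_rec_nth_Cons[OF _ _ i] total_rec_nth_Cons t
            total_rec_nth total_rec_diff total_rec_const) auto
    qed (simp add: Suc)
    have "total_rec (Suc n) (\<lambda>ys. rec_nat (step_eval f (ys ! 0) (tl (tl ys)))
        (\<lambda>k y. if 0 < y then step_eval g (ys ! 0) (k # (y - 1) # tl (tl ys)) else 0) (ys ! 1))"
    proof (intro total_rec_rec_nat total_rec_if decidable_rec_less total_rec_const total_rec_nth)
      show "total_rec (Suc n) (\<lambda>ys. step_eval f (ys ! 0) (tl (tl ys)))" using A by simp
      show "total_rec (Suc (Suc (Suc n))) (\<lambda>ys. step_eval g (tl (tl ys) ! 0)
          (ys ! 0 # (ys ! 1 - 1) # tl (tl (tl (tl ys)))))"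
        by (rule total_rec_cong[OF B]) (auto simp: nth_tl numeral_2_eq_2)
    qed (simp_all add: Suc)
    then show ?thesis
    proof (rule total_rec_cong)
      fix ys :: "nat list" assume "length ys = Suc n"
      then obtain a b zs where ys: "ys = a # b # zs" by (auto simp: Suc length_Suc_conv)
      show "rec_nat (step_eval f (ys ! 0) (tl (tl ys)))
          (\<lambda>k y. if 0 < y then step_eval g (ys ! 0) (k # (y - 1) # tl (tl ys)) else 0) (ys ! 1) =
        step_eval (PrimRec f g) (ys ! 0) (tl ys)"
        unfolding ys step_eval.simps list.sel list.case One_nat_def nth_Cons_Suc nth_Cons_0 ..
    qed
  qed
next
  case (Minim f)
  have F: "total_rec (Suc m) (\<lambda>ys. step_eval f (T ys) (G ys))"
    if "total_rec (Suc m) T" "\<And>ys. length ys = Suc m \<Longrightarrow> length (G ys) = Suc n"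
      "\<And>i. i < Suc n \<Longrightarrow> total_rec (Suc m) (\<lambda>ys. G ys ! i)" for m T G
  proof -
    have "total_rec (Suc m) (\<lambda>ys. step_eval f ((T ys # G ys) ! 0) (tl (T ys # G ys)))"
    proof (rule total_rec_app_list[OF Minim.IH[of "Suc n"]])
      fix i assume "i < Suc (Suc n)"
      then show "total_rec (Suc m) (\<lambda>ys. (T ys # G ys) ! i)"
        using that(1,3) by (cases i) auto
    qed (simp add: that(2))
    then show ?thesis by simp
  qed
  have 1: "total_rec (Suc (Suc n)) (\<lambda>ys. step_eval f (tl ys ! 0) (ys ! 0 # tl (tl ys)))"
  proof (rule F)
    fix i assume "i < Suc n"
    then show "total_rec (Suc (Suc n)) (\<lambda>ys. (ys ! 0 # tl (tl ys)) ! i)"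
      by (cases i) (auto intro!: total_rec_nth total_rec_shift2[of n "\<lambda>xs. xs ! _"])
  qed (auto intro!: total_rec_tl[of _ "\<lambda>xs. xs ! _"] total_rec_nth)
  have 2: "total_rec (Suc (Suc (Suc n))) (\<lambda>ys. step_eval f (tl (tl ys) ! 0) (ys ! 0 # tl (tl (tl ys))))"
  proof (rule F)
    fix i assume "i < Suc n"
    then show "total_rec (Suc (Suc (Suc n))) (\<lambda>ys. (ys ! 0 # tl (tl (tl ys))) ! i)"
      by (cases i) (auto intro!: total_rec_nth total_rec_shift2[of "Suc n" "\<lambda>xs. tl xs ! _"]
          total_rec_tl[of n "\<lambda>xs. xs ! _"])
  qed (auto intro!: total_rec_shift2[of "Suc n" "\<lambda>xs. xs ! _"] total_rec_nth)
  have "total_rec (Suc n) (\<lambda>ys. \<Sum>k<ys ! 0. if step_eval f (ys ! 0) (k # tl ys) = 1 \<and>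
      (\<forall>m<k. 1 < step_eval f (ys ! 0) (m # tl ys)) then Suc k else 0)"
    by (intro total_rec_sum total_rec_if decidable_rec_conj decidable_rec_eq decidable_rec_all_less
        decidable_rec_less total_rec_Suc total_rec_const 1 2 total_rec_nth) simp_all
  then show ?case by simp
qed

lemma total_rec_evalr_iff:
  assumes "total_rec n f"
  obtains r where "\<And>xs y. length xs = n \<Longrightarrow> evalr r xs y \<longleftrightarrow> y = f xs"
  using assms unfolding total_rec_def by (metis evalr_functional)

text \<open>Unbounded search over a decidable relation yields a program that halts exactly where
  some witness exists. The equivalence, rather than mere totality, is what
  \<open>partial_recursive_str\<close> asks of a partial function.\<close>

lemma exists_recf_search:
  assumes P: "decidable_rec (Suc n) P" and h: "total_rec 1 (\<lambda>xs. h (xs ! 0))"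
  shows "\<exists>r. \<forall>xs y. length xs = n \<longrightarrow>
    (evalr r xs y \<longleftrightarrow> (\<exists>i. P (i # xs) \<and> (\<forall>m<i. \<not> P (m # xs)) \<and> y = h i))"
proof -
  \<comment> \<open>The relation is negated because \<open>Minim\<close> looks for a zero.\<close>
  obtain rP where rP: "\<And>xs y. length xs = Suc n \<Longrightarrow> evalr rP xs y \<longleftrightarrow> y = of_bool (\<not> P xs)"
    using total_rec_evalr_iff decidable_rec_not[OF P] unfolding decidable_rec_def by blast
  obtain rh where rh: "\<And>xs y. length xs = 1 \<Longrightarrow> evalr rh xs y \<longleftrightarrow> y = h (xs ! 0)"
    using total_rec_evalr_iff[OF h] by blast
  have min: "evalr (Minim rP) xs i \<longleftrightarrow> P (i # xs) \<and> (\<forall>m<i. \<not> P (m # xs))" if "length xs = n" for xs i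
    using that by (subst evalr.simps) (auto simp: rP)
  have "evalr (Comp rh [Minim rP]) xs y \<longleftrightarrow> (\<exists>i. evalr (Minim rP) xs i \<and> y = h i)" if "length xs = n" for xs y
    using that by (subst evalr.simps) (auto simp: rh list_all2_Cons1)
  then show ?thesis using min by blast
qed

section \<open>Levin's coding theorem\<close>

lemma str_code_surj: "\<exists>p. str_code p = x"
proof (induction x rule: less_induct)
  case (less x)
  consider "x = 0" | "odd x" | "even x" "0 < x" by auto
  then show ?case
  proof cases
    case 1
    then show ?thesis by (metis str_code.simps(1))
  next
    case 2
    then obtain y where x: "x = 2 * y + 1" by (auto elim: oddE)
    then obtain p where "str_code p = y" using less.IH[of y] by auto
    then have "str_code (False # p) = x" using x by simp
    then show ?thesis by blast
  next
    case 3
    then obtain z where "x = 2 * z" "0 < z" by (auto elim!: evenE)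
    then have "x = 2 * (z - 1) + 2" by simp
    then obtain y where x: "x = 2 * y + 2" ..
    then obtain p where "str_code p = y" using less.IH[of y] by auto
    then have "str_code (True # p) = x" using x by simp
    then show ?thesis by blast
  qed
qed

lemma str_code_inject: "str_code p = str_code q \<longleftrightarrow> p = q"
proof
  show "str_code p = str_code q \<Longrightarrow> p = q"
  proof (induction p arbitrary: q)
    case Nil
    then show ?case by (cases q) (auto split: if_splits)
  next
    case (Cons b p)
    then obtain c q' where q: "q = c # q'" by (cases q) (auto split: if_splits)
    have "b = c \<and> str_code p = str_code q'"
      using Cons.prems unfolding q by (auto split: if_splits) presburger+
    then show ?case using Cons.IH q by blast
  qed
qed simp

definition str_decode :: "nat \<Rightarrow> bstring" where
  "str_decode x = (THE p. str_code p = x)"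

lemma str_decode_str_code [simp]: "str_decode (str_code p) = p"
  unfolding str_decode_def by (simp add: str_code_inject)

lemma str_code_str_decode [simp]: "str_code (str_decode x) = x"
  using str_code_surj[of x] by auto

text \<open>\<open>str_code\<close> is bijective base two with digits \<open>1\<close> and
  \<open>2\<close>. Equivalently, \<open>Suc (str_code p)\<close> in ordinary binary is a leading
  \<open>1\<close> above the letters of \<open>p\<close>, the head being the lowest bit. Its number
  of digits thus determines the length of \<open>p\<close>.\<close>

lemma str_code_bounds: "2 ^ length p \<le> str_code p + 1" "str_code p + 1 < 2 ^ Suc (length p)"
  by (induction p) auto

lemma length_le_str_code: "length p \<le> str_code p"
  using str_code_bounds(1)[of p] less_exp[of "length p"] by linarith

text \<open>This is the integer part of the binary logarithm of \<open>x + 1\<close>, written as a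
  bounded count so that its recursiveness is immediate.\<close>

definition code_length :: "nat \<Rightarrow> nat" where
  "code_length x = (\<Sum>j<x. if 2 ^ Suc j \<le> x + 1 then 1 else 0)"

lemma code_length_str_code [simp]: "code_length (str_code p) = length p"
proof -
  let ?x = "str_code p"
  have iff: "2 ^ Suc j \<le> ?x + 1 \<longleftrightarrow> j < length p" for j
  proof
    assume "2 ^ Suc j \<le> ?x + 1"
    then have "(2::nat) ^ Suc j < 2 ^ Suc (length p)" using str_code_bounds(2)[of p] by linarith
    then show "j < length p" by simp
  next
    assume "j < length p"
    then have "(2::nat) ^ Suc j \<le> 2 ^ length p" by (intro power_increasing) auto
    then show "2 ^ Suc j \<le> ?x + 1" using str_code_bounds(1)[of p] by linarith
  qed
  have *: "{j \<in> {..<?x}. 2 ^ Suc j \<le> ?x + 1} = {..<length p}"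
    unfolding iff using length_le_str_code[of p] by auto
  have "code_length ?x = card {j \<in> {..<?x}. 2 ^ Suc j \<le> ?x + 1}"
    unfolding code_length_def card_eq_sum by (rule sum.inter_filter[symmetric]) simp
  then show ?thesis by (simp only: * card_lessThan)
qed

text \<open>
  \<open>str_code\<close> treats the head of a string as its least significant digit, whereas here it is the
  most significant one, so that the extensions of \<open>p\<close> occupy the dyadic interval from
  \<open>bin_val p / 2 ^ length p\<close> to \<open>(bin_val p + 1) / 2 ^ length p\<close>.
\<close>

fun bin_val :: "bstring \<Rightarrow> nat" where
  "bin_val [] = 0"
| "bin_val (b # bs) = of_bool b * 2 ^ length bs + bin_val bs"

lemma bin_val_less: "bin_val p < 2 ^ length p"
proof (induction p)
  case (Cons b p)
  then show ?case by (cases b) simp_all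
qed simp

lemma bin_val_append: "bin_val (p @ q) = bin_val p * 2 ^ length q + bin_val q"
  by (induction p) (simp_all add: power_add add_mult_distrib)

lemma bin_val_surj: "v < 2 ^ l \<Longrightarrow> \<exists>p. length p = l \<and> bin_val p = v"
proof (induction l arbitrary: v)
  case (Suc l)
  show ?case
  proof (cases "v < 2 ^ l")
    case True
    then obtain p where "length p = l" "bin_val p = v" using Suc.IH by blast
    then show ?thesis by (intro exI[of _ "False # p"]) auto
  next
    case False
    then have "v - 2 ^ l < 2 ^ l" using Suc.prems by auto
    then obtain p where "length p = l" "bin_val p = v - 2 ^ l" using Suc.IH by blast
    then show ?thesis using False by (intro exI[of _ "True # p"]) auto
  qed
qed simp

text \<open>Bit \<open>j\<close> of \<open>Suc x\<close> is letter \<open>j\<close> of the string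
  coded by \<open>x\<close>. Giving it the weight of position \<open>j\<close> from the left
  reverses the order of significance and yields \<open>bin_val\<close> on codes.\<close>

definition code_val :: "nat \<Rightarrow> nat" where
  "code_val x = (\<Sum>j<code_length x. if odd (Suc x div 2 ^ j) then 2 ^ (code_length x - Suc j) else 0)"

lemma code_val_str_code [simp]: "code_val (str_code p) = bin_val p"
proof (induction p)
  case Nil
  then show ?case by (simp add: code_val_def code_length_def)
next
  case (Cons b p)
  let ?x = "str_code (b # p)" and ?y = "str_code p"
  have x2: "Suc ?x div 2 = Suc ?y" and odd: "odd (Suc ?x) = b" by auto
  have div: "Suc ?x div 2 ^ Suc j = Suc ?y div 2 ^ j" for j
    by (simp add: div_mult2_eq x2 del: str_code.simps)
  have "code_val ?x = (\<Sum>j<Suc (length p). if odd (Suc ?x div 2 ^ j) then 2 ^ (length p - j) else 0)"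
    unfolding code_val_def code_length_str_code length_Cons diff_Suc_Suc by (rule refl)
  also have "\<dots> = (if odd (Suc ?x) then 2 ^ length p else 0) +
      (\<Sum>j<length p. if odd (Suc ?y div 2 ^ j) then 2 ^ (length p - Suc j) else 0)"
    unfolding sum.lessThan_Suc_shift div by simp
  also have "\<dots> = bin_val (b # p)"
    using Cons unfolding odd code_val_def code_length_str_code by simp
  finally show ?case .
qed

lemma total_rec_code_length:
  assumes "total_rec n a" shows "total_rec n (\<lambda>xs. code_length (a xs))"
proof (rule total_rec_app1[OF _ assms])
  show "total_rec 1 (\<lambda>xs. code_length (xs ! 0))"
    unfolding code_length_def
    by (intro total_rec_sum total_rec_if decidable_rec_le total_rec_power total_rec_add total_rec_Suc
        total_rec_const total_rec_nth total_rec_tl[of 1 "\<lambda>xs. xs ! _"]) auto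
qed

lemma total_rec_code_val:
  assumes "total_rec n a" shows "total_rec n (\<lambda>xs. code_val (a xs))"
proof (rule total_rec_app1[OF _ assms])
  show "total_rec 1 (\<lambda>xs. code_val (xs ! 0))"
    unfolding code_val_def
    by (intro total_rec_sum total_rec_if decidable_rec_odd total_rec_div2_power total_rec_diff
        total_rec_power total_rec_Suc total_rec_code_length
        total_rec_const total_rec_nth total_rec_tl[of 1 "\<lambda>xs. xs ! _"]) auto
qed

text \<open>Clearing denominators turns the comparison of a coded rational with a power of one half
  into a comparison of natural numbers, hence into a decidable one.\<close>

lemma rat_code_greater_iff:
  "(1 / 2) ^ k < rat_code y \<longleftrightarrow>
    snd (prod_decode (fst (prod_decode y))) * 2 ^ k + Suc (snd (prod_decode y))
      < fst (prod_decode (fst (prod_decode y))) * 2 ^ k"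
proof -
  obtain p d where y: "prod_decode y = (p, d)" by fastforce
  obtain a b where p: "prod_decode p = (a, b)" by fastforce
  have "(1 / 2) ^ k < rat_code y \<longleftrightarrow> 1 / 2 ^ k < (real a - real b) / (real d + 1)"
    by (simp add: rat_code_def y p power_one_over)
  also have "\<dots> \<longleftrightarrow> real d + 1 < (real a - real b) * 2 ^ k"
    by (simp add: field_simps)
  also have "\<dots> \<longleftrightarrow> real (b * 2 ^ k + Suc d) < real (a * 2 ^ k)"
    by (simp add: algebra_simps)
  also have "\<dots> \<longleftrightarrow> b * 2 ^ k + Suc d < a * 2 ^ k"
    by (rule of_nat_less_iff)
  finally show ?thesis by (simp add: y p)
qed

lemma real_two_power_diff: "k \<le> i \<Longrightarrow> real (2 ^ (i - k)) = 2 ^ i * (1 / 2) ^ k"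
  unfolding of_nat_power of_nat_numeral by (simp add: power_diff power_one_over)

text \<open>The exponents are distinct, so the sum is dominated by a geometric series starting at
  the smallest exponent, that is, by twice the largest term.\<close>

lemma sum_half_powers_le:
  assumes "finite K" "\<And>k. k \<in> K \<Longrightarrow> (1 / 2) ^ k \<le> m" "0 \<le> m"
  shows "(\<Sum>k\<in>K. (1 / 2) ^ k) \<le> 2 * (m::real)"
proof (cases "K = {}")
  case False
  define k0 where "k0 = Min K"
  have geom: "(\<Sum>k\<in>{k0..<k0 + d}. (1 / 2 :: real) ^ k) \<le> 2 * (1 / 2) ^ k0 - 2 * (1 / 2) ^ (k0 + d)" for d
    by (induction d) auto
  have "K \<subseteq> {k0..<k0 + Suc (Max K)}"
    using Max_ge[OF assms(1)] Min_le[OF assms(1)] by (auto simp: k0_def less_Suc_eq_le intro!: trans_le_add2)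
  then have "(\<Sum>k\<in>K. (1 / 2 :: real) ^ k) \<le> (\<Sum>k\<in>{k0..<k0 + Suc (Max K)}. (1 / 2) ^ k)"
    by (intro sum_mono2) auto
  also have "\<dots> \<le> 2 * (1 / 2) ^ k0"
    using geom[of "Suc (Max K)"] zero_le_power[of "1 / 2 :: real" "k0 + Suc (Max K)"] by linarith
  also have "\<dots> \<le> 2 * m"
    using assms(2)[of k0] False assms(1) by (simp add: k0_def)
  finally show ?thesis .
qed (use assms in simp)

section \<open>A prefix-free code from a lower-computable semimeasure\<close>

locale lower_computable_semimeasure =
  fixes F :: "nat \<Rightarrow> nat \<Rightarrow> nat" and \<mu> :: "bstring \<Rightarrow> real"
  assumes F_rec: "total_rec 2 (\<lambda>xs. F (xs ! 0) (xs ! 1))"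
    and F_lim: "(\<lambda>n. rat_code (F n (str_code s))) \<longlonglongrightarrow> \<mu> s"
    and F_le: "rat_code (F n (str_code s)) \<le> \<mu> s"
    and nonneg: "0 \<le> \<mu> s"
    and sum_le_1: "finite S \<Longrightarrow> (\<Sum>s\<in>S. \<mu> s) \<le> 1"
begin

text \<open>
  A request \<open>i\<close> encodes a string, an exponent \<open>k\<close> and a stage \<open>n\<close>; it is active if \<open>n\<close> is the first
  stage at which the approximation of \<open>\<mu>\<close> exceeds \<open>2\<close> to the power \<open>-k\<close>. Active requests receive
  consecutive intervals of length \<open>weight i\<close>, of total length at most \<open>2\<close>. After halving, the
  interval of request \<open>i\<close> contains a dyadic interval whose codewords have length \<open>k + 2\<close>.
\<close>

definition req_str :: "nat \<Rightarrow> nat" where "req_str i = fst (prod_decode i)"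
definition req_exp :: "nat \<Rightarrow> nat" where "req_exp i = fst (prod_decode (snd (prod_decode i)))"
definition req_stage :: "nat \<Rightarrow> nat" where "req_stage i = snd (prod_decode (snd (prod_decode i)))"

definition active :: "nat \<Rightarrow> bool" where
  "active i \<longleftrightarrow> (1 / 2) ^ req_exp i < rat_code (F (req_stage i) (req_str i)) \<and>
    (\<forall>m<req_stage i. \<not> (1 / 2) ^ req_exp i < rat_code (F m (req_str i)))"

definition weight :: "nat \<Rightarrow> real" where
  "weight i = (if active i then (1 / 2) ^ req_exp i else 0)"

text \<open>\<open>2 ^ i\<close> times the left end of the \<open>i\<close>-th interval, which makes it an integer.\<close>

definition scaled_start :: "nat \<Rightarrow> nat" where
  "scaled_start i = (\<Sum>j<i. if active j then 2 ^ (i - req_exp j) else 0)"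

definition assigned :: "nat \<Rightarrow> nat \<Rightarrow> bool" where
  "assigned i x \<longleftrightarrow> active i \<and> code_length x = req_exp i + 2 \<and>
     scaled_start i * 2 ^ code_length x \<le> code_val x * 2 ^ Suc i \<and>
     Suc (code_val x) * 2 ^ Suc i \<le> (scaled_start i + 2 ^ (i - req_exp i)) * 2 ^ code_length x"

text \<open>This is what makes \<open>2 ^ i\<close> a sufficient scale: the exponents
  \<open>i - req_exp j\<close> in \<open>scaled_start\<close> are never truncated at zero.\<close>

lemma req_exp_le: "req_exp i \<le> i"
proof -
  obtain x y where i: "prod_decode i = (x, y)" by fastforce
  obtain k n where y: "prod_decode y = (k, n)" by fastforce
  have "i = prod_encode (x, prod_encode (k, n))" by (metis i y prod_decode_inverse)
  then have "k \<le> i" using le_prod_encode_1[of k n] le_prod_encode_2[of "prod_encode (k, n)" x] by linarith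
  then show ?thesis by (simp add: req_exp_def i y)
qed

lemma weight_nonneg: "0 \<le> weight i"
  by (simp add: weight_def)

lemma decidable_active:
  assumes "total_rec n a"
  shows "decidable_rec n (\<lambda>xs. active (a xs))"
proof -
  have f: "total_rec k (\<lambda>xs. F (b xs) (c xs))" if "total_rec k b" "total_rec k c" for k b c
    using total_rec_app2[OF F_rec that] .
  have "decidable_rec 1 (\<lambda>xs. active (xs ! 0))"
    unfolding active_def rat_code_greater_iff req_str_def req_exp_def req_stage_def
    by (intro decidable_rec_conj decidable_rec_all_less decidable_rec_not decidable_rec_less
        total_rec_add total_rec_mult total_rec_power total_rec_const total_rec_Suc
        total_rec_prod_decode f total_rec_nth total_rec_tl[of 1 "\<lambda>xs. xs ! _"]) auto
  then show ?thesis unfolding decidable_rec_def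
    using total_rec_app1[of "\<lambda>i. of_bool (active i)", OF _ assms] by simp
qed

lemma decidable_assigned: "decidable_rec 2 (\<lambda>xs. assigned (xs ! 0) (xs ! 1))"
proof -
  have "total_rec 1 (\<lambda>xs. scaled_start (xs ! 0))"
    unfolding scaled_start_def req_exp_def
    by (intro total_rec_sum total_rec_if decidable_active total_rec_diff total_rec_power total_rec_const
        total_rec_prod_decode total_rec_nth total_rec_tl[of 1 "\<lambda>xs. xs ! _"]) auto
  note s = total_rec_app1[OF this]
  show ?thesis
    unfolding assigned_def req_exp_def
    by (intro decidable_rec_conj decidable_active decidable_rec_eq decidable_rec_le s
        total_rec_add total_rec_mult total_rec_power total_rec_const total_rec_Suc total_rec_diff
        total_rec_prod_decode total_rec_code_length total_rec_code_val total_rec_nth) auto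
qed

text \<open>Two different stages cannot both be the first at which the same string passes the same
  threshold.\<close>

lemma inj_on_active: "inj_on (\<lambda>i. (req_str i, req_exp i)) {i. active i}"
proof (rule inj_onI)
  fix i j assume *: "i \<in> {i. active i}" "j \<in> {i. active i}"
    "(req_str i, req_exp i) = (req_str j, req_exp j)"
  then have eq: "req_str i = req_str j" "req_exp i = req_exp j" by auto
  have "\<not> req_stage i < req_stage j" "\<not> req_stage j < req_stage i"
    using *(1,2) eq by (auto simp: active_def)
  then have "prod_decode (snd (prod_decode i)) = prod_decode (snd (prod_decode j))"
    using eq(2) unfolding req_exp_def req_stage_def by (intro prod_eqI) auto
  then have "prod_decode i = prod_decode j"
    using eq(1) unfolding req_str_def by (intro prod_eqI) auto
  then show "i = j" by simp
qed

text \<open>Active requests inject into pairs of a string \<open>s\<close> and an exponent whose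
  power of one half is at most \<open>\<mu> s\<close>. For each \<open>s\<close> these powers sum to
  at most \<open>2 * \<mu> s\<close>, and the total mass of \<open>\<mu>\<close> is at most
  \<open>1\<close>.\<close>

lemma sum_weight_le: "(\<Sum>i<n. weight i) \<le> 2"
proof -
  define T where "T = {i \<in> {..<n}. active i}"
  define X where "X = str_decode ` req_str ` T"
  define K where "K s = {k \<in> req_exp ` T. (1 / 2) ^ k \<le> \<mu> s}" for s
  have fin: "finite T" "finite X" "\<And>s. finite (K s)" by (auto simp: T_def X_def K_def)
  have "(\<Sum>i<n. weight i) = (\<Sum>i\<in>T. (1 / 2) ^ req_exp i)"
    unfolding weight_def T_def by (simp add: sum.inter_filter[symmetric])
  also have "\<dots> = (\<Sum>(s, k)\<in>(\<lambda>i. (str_decode (req_str i), req_exp i)) ` T. (1 / 2) ^ k)"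
  proof (subst sum.reindex)
    show "inj_on (\<lambda>i. (str_decode (req_str i), req_exp i)) T"
      using inj_on_active unfolding inj_on_def T_def
      by (metis (mono_tags, lifting) Pair_inject mem_Collect_eq str_code_str_decode)
  qed simp
  also have "\<dots> \<le> (\<Sum>(s, k)\<in>Sigma X K. (1 / 2) ^ k)"
  proof (rule sum_mono2)
    show "(\<lambda>i. (str_decode (req_str i), req_exp i)) ` T \<subseteq> Sigma X K"
    proof clarify
      fix i assume i: "i \<in> T"
      then have "(1 / 2) ^ req_exp i < rat_code (F (req_stage i) (req_str i))"
        by (simp add: T_def active_def)
      also have "\<dots> \<le> \<mu> (str_decode (req_str i))"
        using F_le[of "req_stage i" "str_decode (req_str i)"] by simp
      finally show "str_decode (req_str i) \<in> X \<and> req_exp i \<in> K (str_decode (req_str i))"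
        using i by (auto simp: X_def K_def)
    qed
  qed (use fin in auto)
  also have "\<dots> = (\<Sum>s\<in>X. \<Sum>k\<in>K s. (1 / 2) ^ k)"
    using fin by (subst sum.Sigma) auto
  also have "\<dots> \<le> (\<Sum>s\<in>X. 2 * \<mu> s)"
    by (intro sum_mono sum_half_powers_le) (use fin nonneg in \<open>auto simp: K_def\<close>)
  also have "\<dots> \<le> 2"
    using sum_le_1[OF fin(2)] by (simp add: sum_distrib_left[symmetric])
  finally show ?thesis .
qed

lemma scaled_start_eq: "real (scaled_start i) = 2 ^ i * (\<Sum>j<i. weight j)"
proof -
  have "real (if active j then 2 ^ (i - req_exp j) else 0) = 2 ^ i * weight j" if "j < i" for j
    using req_exp_le[of j] that real_two_power_diff[of "req_exp j" i] by (simp add: weight_def del: of_nat_power)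
  then show ?thesis unfolding scaled_start_def of_nat_sum sum_distrib_left by (intro sum.cong) auto
qed

text \<open>Removing the scale \<open>2 ^ Suc i\<close> recovers the geometric meaning: the dyadic
  interval of \<open>p\<close> lies inside the interval of request \<open>i\<close>. The factor one
  half shrinks the total length from \<open>2\<close> to \<open>1\<close>.\<close>

lemma assigned_iff:
  "assigned i (str_code p) \<longleftrightarrow> active i \<and> length p = req_exp i + 2 \<and>
     (\<Sum>j<i. weight j) / 2 \<le> real (bin_val p) / 2 ^ length p \<and>
     (real (bin_val p) + 1) / 2 ^ length p \<le> (\<Sum>j<Suc i. weight j) / 2"
proof (cases "active i")
  case True
  have w: "real (2 ^ (i - req_exp i)) = 2 ^ i * weight i"
    using real_two_power_diff[OF req_exp_le] True by (simp add: weight_def del: of_nat_power)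
  have "scaled_start i * 2 ^ length p \<le> bin_val p * 2 ^ Suc i \<longleftrightarrow>
      real (scaled_start i * 2 ^ length p) \<le> real (bin_val p * 2 ^ Suc i)"
    by (rule of_nat_le_iff[symmetric])
  also have "\<dots> \<longleftrightarrow> 2 ^ i * ((\<Sum>j<i. weight j) * 2 ^ length p) \<le> 2 ^ i * (2 * real (bin_val p))"
    by (simp add: scaled_start_eq algebra_simps)
  also have "\<dots> \<longleftrightarrow> (\<Sum>j<i. weight j) / 2 \<le> real (bin_val p) / 2 ^ length p"
    by (subst mult_le_cancel_left_pos) (auto simp: field_simps)
  finally have 1: "scaled_start i * 2 ^ length p \<le> bin_val p * 2 ^ Suc i \<longleftrightarrow>
    (\<Sum>j<i. weight j) / 2 \<le> real (bin_val p) / 2 ^ length p" .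
  have "Suc (bin_val p) * 2 ^ Suc i \<le> (scaled_start i + 2 ^ (i - req_exp i)) * 2 ^ length p \<longleftrightarrow>
      real (Suc (bin_val p) * 2 ^ Suc i) \<le> real ((scaled_start i + 2 ^ (i - req_exp i)) * 2 ^ length p)"
    by (rule of_nat_le_iff[symmetric])
  also have "\<dots> \<longleftrightarrow> 2 ^ i * (2 * (real (bin_val p) + 1)) \<le> 2 ^ i * ((\<Sum>j<Suc i. weight j) * 2 ^ length p)"
    unfolding of_nat_mult of_nat_add w scaled_start_eq by (simp add: algebra_simps)
  also have "\<dots> \<longleftrightarrow> (real (bin_val p) + 1) / 2 ^ length p \<le> (\<Sum>j<Suc i. weight j) / 2"
    by (subst mult_le_cancel_left_pos) (auto simp: field_simps)
  finally show ?thesis using True 1 by (simp add: assigned_def)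
qed (simp add: assigned_def)

text \<open>The interval of the extension \<open>q\<close> lies inside that of \<open>p\<close>,
  while intervals of different requests do not overlap, so the requests agree. Then both strings
  have the length prescribed by the request, and the extension is trivial. For \<open>p = q\<close>
  this says that a codeword belongs to one request only.\<close>

lemma assigned_prefix:
  assumes "assigned i (str_code p)" "assigned j (str_code q)" "prefix p q"
  shows "i = j \<and> p = q"
proof -
  obtain r where q: "q = p @ r" using assms(3) by (auto simp: prefix_def)
  have r: "real (bin_val r) + 1 \<le> 2 ^ length r"
    using bin_val_less[of r] by (metis Suc_leI add.commute of_nat_Suc of_nat_le_iff of_nat_numeral of_nat_power)
  have lo: "real (bin_val p) / 2 ^ length p \<le> real (bin_val q) / 2 ^ length q"
    by (simp add: q bin_val_append power_add field_simps)
  have hi: "(real (bin_val q) + 1) / 2 ^ length q \<le> (real (bin_val p) + 1) / 2 ^ length p"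
    using mult_left_mono[OF r, of "2 ^ length p"] by (simp add: q bin_val_append power_add field_simps)
  have lt: "real (bin_val q) / 2 ^ length q < (real (bin_val q) + 1) / 2 ^ length q"
    by (simp add: divide_strict_right_mono)
  have mono: "(\<Sum>j<Suc i. weight j) \<le> (\<Sum>j<k. weight j)" if "i < k" for i k
    by (rule sum_mono2) (use that weight_nonneg in auto)
  have "i = j"
  proof (rule ccontr)
    assume "i \<noteq> j"
    then consider "i < j" | "j < i" by linarith
    then show False
      using mono[of i j] mono[of j i] assms(1,2) lo hi lt unfolding assigned_iff
      by cases linarith+
  qed
  then show ?thesis using assms(1,2) q by (auto simp: assigned_iff)
qed

definition code_computer :: "bstring \<Rightarrow> bstring option" where
  "code_computer p = (if \<exists>i. assigned i (str_code p)
     then Some (str_decode (req_str (THE i. assigned i (str_code p)))) else None)"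

lemma code_computer_eq:
  assumes "assigned i (str_code p)"
  shows "code_computer p = Some (str_decode (req_str i))"
proof -
  have "(THE i. assigned i (str_code p)) = i"
    using assms assigned_prefix[of _ p _ p] by blast
  then show ?thesis using assms by (auto simp: code_computer_def)
qed

lemma code_computer_Some_iff:
  "code_computer p = Some t \<longleftrightarrow> (\<exists>i. assigned i (str_code p) \<and> t = str_decode (req_str i))"
proof (cases "\<exists>i. assigned i (str_code p)")
  case True
  then obtain i where i: "assigned i (str_code p)" ..
  then have "assigned j (str_code p) \<longleftrightarrow> j = i" for j
    using assigned_prefix[of i p j p] by auto
  then show ?thesis using code_computer_eq[OF i] by auto
qed (auto simp: code_computer_def)

text \<open>Searching for the request that owns the given string halts exactly on codewords. As the
  owner is unique, the least one found is the one chosen by \<open>THE\<close>.\<close>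

lemma computer_code_computer: "computer code_computer"
  unfolding computer_def
proof (intro conjI allI impI)
  have h: "total_rec 1 (\<lambda>xs. req_str (xs ! 0))"
    unfolding req_str_def by (intro total_rec_prod_decode total_rec_nth) simp
  have d: "decidable_rec (Suc 1) (\<lambda>xs. assigned (xs ! 0) (xs ! 1))"
    using decidable_assigned by (simp only: numeral_2_eq_2 One_nat_def)
  obtain r where
    "\<forall>xs y. length xs = 1 \<longrightarrow> (evalr r xs y \<longleftrightarrow> (\<exists>i. assigned ((i # xs) ! 0) ((i # xs) ! 1) \<and>
      (\<forall>m<i. \<not> assigned ((m # xs) ! 0) ((m # xs) ! 1)) \<and> y = req_str i))"
    using exists_recf_search[where h = req_str, OF d h] ..
  then have r: "evalr r [x] y \<longleftrightarrow> (\<exists>i. assigned i x \<and> (\<forall>m<i. \<not> assigned m x) \<and> y = req_str i)" for x y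
    by simp
  have uniq: "assigned i (str_code p) \<Longrightarrow> assigned j (str_code p) \<Longrightarrow> i = j" for i j p
    using assigned_prefix[of i p j p] by simp
  have "evalr r [str_code p] y \<longleftrightarrow> (\<exists>t. code_computer p = Some t \<and> y = str_code t)" for p y
  proof
    assume "evalr r [str_code p] y"
    then obtain i where "assigned i (str_code p)" "y = req_str i" unfolding r by blast
    then show "\<exists>t. code_computer p = Some t \<and> y = str_code t"
      using code_computer_eq by auto
  next
    assume "\<exists>t. code_computer p = Some t \<and> y = str_code t"
    then obtain i where i: "assigned i (str_code p)" "y = req_str i"
      by (auto simp: code_computer_Some_iff)
    moreover have "\<not> assigned m (str_code p)" if "m < i" for m
      using uniq[OF i(1)] that by blast
    ultimately show "evalr r [str_code p] y" unfolding r by blast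
  qed
  then show "partial_recursive_str code_computer"
    unfolding partial_recursive_str_def by blast
next
  fix p q assume "p \<in> dom code_computer" "q \<in> dom code_computer" "prefix p q"
  then show "p = q" using assigned_prefix by (auto simp: code_computer_Some_iff)
qed

text \<open>With the least \<open>k\<close> whose power of one half lies below
  \<open>\<mu> s\<close>, minimality (or \<open>\<mu> s <= 1\<close> if \<open>k = 0\<close>) gives
  that \<open>\<mu> s\<close> is at most twice this power. The codeword has two letters more than
  \<open>k\<close>, which turns the factor \<open>2\<close> into \<open>8\<close>.\<close>

lemma exists_codeword:
  assumes pos: "0 < \<mu> s"
  shows "\<exists>p. code_computer p = Some s \<and> \<mu> s \<le> 8 * (1 / 2) ^ length p"
proof -
  have "\<exists>k. (1 / 2) ^ k < \<mu> s" using real_arch_pow_inv[OF pos, of "1 / 2"] by simp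
  define k where "k = (LEAST k. (1 / 2) ^ k < \<mu> s)"
  have k: "(1 / 2) ^ k < \<mu> s" unfolding k_def by (rule LeastI_ex) fact
  have k': "\<mu> s \<le> 2 * (1 / 2) ^ k"
  proof (cases k)
    case 0
    then show ?thesis using sum_le_1[of "{s}"] by simp
  next
    case (Suc l)
    then have "\<not> (1 / 2) ^ l < \<mu> s" using not_less_Least[of l "\<lambda>k. (1 / 2) ^ k < \<mu> s"] by (simp add: k_def)
    then show ?thesis by (simp add: Suc)
  qed
  have "\<forall>\<^sub>F n in sequentially. (1 / 2) ^ k < rat_code (F n (str_code s))"
    using order_tendstoD(1)[OF F_lim k] .
  then have ex: "\<exists>n. (1 / 2) ^ k < rat_code (F n (str_code s))"
    by (auto dest: eventually_happens'[OF sequentially_bot])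
  define n where "n = (LEAST n. (1 / 2) ^ k < rat_code (F n (str_code s)))"
  have n: "(1 / 2) ^ k < rat_code (F n (str_code s))" unfolding n_def by (rule LeastI_ex) fact
  have n': "\<not> (1 / 2) ^ k < rat_code (F m (str_code s))" if "m < n" for m
    using not_less_Least that unfolding n_def by blast
  define i where "i = prod_encode (str_code s, prod_encode (k, n))"
  have sel: "req_str i = str_code s" "req_exp i = k" "req_stage i = n"
    by (simp_all add: i_def req_str_def req_exp_def req_stage_def)
  have act: "active i" unfolding active_def sel using n n' by blast
  define a where "a = (\<Sum>j<i. weight j)"
  have a: "0 \<le> a" "(\<Sum>j<Suc i. weight j) = a + (1 / 2) ^ k"
    using act by (simp_all add: a_def sum_nonneg weight_nonneg weight_def sel)
  have a2: "a + (1 / 2) ^ k \<le> 2" using sum_weight_le[of "Suc i"] a(2) by simp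
  \<comment> \<open>The left end \<open>a / 2\<close> is rounded up to the grid of mesh
    \<open>(1 / 2) ^ (k + 2)\<close>. The halved interval is two meshes long, so a full cell remains
    after the rounding.\<close>
  define v where "v = nat \<lceil>a * 2 ^ Suc k\<rceil>"
  have v: "a * 2 ^ Suc k \<le> real v" "real v < a * 2 ^ Suc k + 1"
    using a(1) unfolding v_def by (auto simp: of_nat_nat ceiling_correct) linarith+
  have v': "real v + 1 \<le> (a + (1 / 2) ^ k) * 2 ^ Suc k"
    using v(2) by (simp add: algebra_simps power_one_over)
  also have "\<dots> \<le> 2 * 2 ^ Suc k" using a2 by (intro mult_right_mono) auto
  finally have "real v < real (2 ^ (k + 2))" by (simp add: power_add)
  then have "v < 2 ^ (k + 2)" by (simp only: of_nat_less_iff)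
  then obtain p where p: "length p = k + 2" "bin_val p = v" using bin_val_surj by blast
  have "assigned i (str_code p)"
    unfolding assigned_iff a(2) using act p v(1) v'
    by (simp add: sel a_def[symmetric] power_add field_simps)
  then have "code_computer p = Some s" by (simp add: code_computer_eq sel)
  moreover have "\<mu> s \<le> 8 * (1 / 2) ^ length p" using k' p(1) by (simp add: power_add)
  ultimately show ?thesis by blast
qed

text \<open>The optimal computer simulates \<open>code_computer\<close> at the cost of
  \<open>d\<close> extra bits, hence the factor \<open>2 ^ d\<close>.\<close>

lemma Kc_upper_bound:
  assumes "optimal_computer U"
  shows "\<exists>c>0. \<forall>s. \<mu> s \<le> c * (1 / 2) ^ Kc U s"
proof -
  have "\<exists>d::nat. \<forall>p t. code_computer p = Some t \<longrightarrow> (\<exists>p'. U p' = Some t \<and> length p' \<le> length p + d)"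
    using assms computer_code_computer by (simp add: optimal_computer_def)
  then obtain d where
    d: "\<forall>p t. code_computer p = Some t \<longrightarrow> (\<exists>p'. U p' = Some t \<and> length p' \<le> length p + d)" ..
  have "\<mu> s \<le> (8 * 2 ^ d) * (1 / 2) ^ Kc U s" for s
  proof (cases "\<mu> s = 0")
    case False
    then have "0 < \<mu> s" using nonneg[of s] by simp
    then obtain p where p: "code_computer p = Some s" "\<mu> s \<le> 8 * (1 / 2) ^ length p"
      using exists_codeword by blast
    obtain p' where p': "U p' = Some s" "length p' \<le> length p + d" using d p(1) by blast
    have "Kc U s \<le> length p'" unfolding Kc_def by (rule Least_le) (use p' in blast)
    then have "Kc U s \<le> length p + d" using p' by linarith
    then have "(1 / 2 :: real) ^ (length p + d) \<le> (1 / 2) ^ Kc U s" by (intro power_decreasing) auto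
    then have "(1 / 2 :: real) ^ length p \<le> 2 ^ d * (1 / 2) ^ Kc U s"
      by (simp add: power_add power_one_over field_simps)
    then show ?thesis using p(2) by linarith
  qed simp
  then show ?thesis by (intro exI[of _ "8 * 2 ^ d"]) auto
qed

end

section \<open>Positive semi-definite matrices\<close>

lemma qform_expand_last:
  fixes a :: "nat \<Rightarrow> nat \<Rightarrow> complex"
  shows "(\<Sum>i<Suc n. \<Sum>j<Suc n. cnj (v i) * a i j * v j) =
    (\<Sum>i<n. \<Sum>j<n. cnj (v i) * a i j * v j) + (\<Sum>i<n. cnj (v i) * a i n) * v n +
    cnj (v n) * (\<Sum>j<n. a n j * v j) + cnj (v n) * a n n * v n"
  by (simp add: sum.distrib sum_distrib_left sum_distrib_right mult.assoc add.assoc)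

text \<open>A vanishing diagonal entry leaves nothing to compensate the cross terms: on the vector
  with entry \<open>t\<close> at \<open>i\<close> and \<open>1\<close> at \<open>n\<close> the form
  equals \<open>s * (s * Re (a i i) - 2)\<close> times the squared modulus of \<open>a i n\<close>,
  which is negative for the small \<open>s\<close> chosen here unless \<open>a i n\<close>
  vanishes.\<close>

lemma pos_form_off_diag_zero:
  fixes a :: "nat \<Rightarrow> nat \<Rightarrow> complex"
  assumes herm: "\<And>i j. i < Suc n \<Longrightarrow> j < Suc n \<Longrightarrow> a i j = cnj (a j i)"
    and pos: "\<And>v. 0 \<le> Re (\<Sum>i<Suc n. \<Sum>j<Suc n. cnj (v i) * a i j * v j)"
    and zero: "a n n = 0" and i: "i < n"
  shows "a i n = 0"
proof (rule ccontr)
  assume nz: "a i n \<noteq> 0"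
  define m where "m = \<bar>Re (a i i)\<bar>"
  define s where "s = 1 / (m + 1)"
  have s: "0 < s" "s * m < 1" by (auto simp: s_def m_def)
  define t where "t = - complex_of_real s * a i n"
  define w where "w j = (if j = i then t else if j = n then 1 else 0)" for j
  have ni: "a n i = cnj (a i n)" using herm[of n i] i by simp
  have "(\<Sum>i<Suc n. \<Sum>j<Suc n. cnj (w i) * a i j * w j) =
      cnj t * a i i * t + cnj t * a i n + a n i * t"
  proof -
    have single: "(\<Sum>l<n. f l) = f i" if "\<And>l. l < n \<Longrightarrow> l \<noteq> i \<Longrightarrow> f l = 0" for f :: "nat \<Rightarrow> complex"
      using i that by (subst sum.mono_neutral_right[of "{..<n}" "{i}"]) auto
    have w: "w i = t" "w n = 1" "\<And>l. l < n \<Longrightarrow> l \<noteq> i \<Longrightarrow> w l = 0" using i by (auto simp: w_def)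
    have "(\<Sum>k<n. \<Sum>l<n. cnj (w k) * a k l * w l) = (\<Sum>k<n. cnj (w k) * a k i * w i)"
      by (intro sum.cong refl single) (auto simp: w)
    also have "\<dots> = cnj (w i) * a i i * w i" by (rule single) (auto simp: w)
    finally have 1: "(\<Sum>k<n. \<Sum>l<n. cnj (w k) * a k l * w l) = cnj t * a i i * t" by (simp add: w)
    have 2: "(\<Sum>k<n. cnj (w k) * a k n) = cnj (w i) * a i n" by (rule single) (auto simp: w)
    have 3: "(\<Sum>l<n. a n l * w l) = a n i * w i" by (rule single) (auto simp: w)
    show ?thesis unfolding qform_expand_last 1 2 3 w zero by simp
  qed
  then have "0 \<le> Re (cnj t * a i i * t + cnj t * a i n + a n i * t)" using pos[of w] by simp
  also have "\<dots> = (cmod (a i n))\<^sup>2 * (s * (s * Re (a i i) - 2))"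
    unfolding cmod_power2 by (simp add: t_def ni algebra_simps power2_eq_square)
  finally have "0 \<le> (cmod (a i n))\<^sup>2 * (s * (s * Re (a i i) - 2))" .
  moreover have "s * Re (a i i) \<le> s * m" using s(1) by (simp add: m_def)
  then have "s * Re (a i i) - 2 < 0" using s by linarith
  then have "s * (s * Re (a i i) - 2) < 0" using s by (intro mult_pos_neg) auto
  then have "(cmod (a i n))\<^sup>2 * (s * (s * Re (a i i) - 2)) < 0" by (rule mult_pos_neg[rotated]) (use nz in simp)
  ultimately show False by simp
qed

text \<open>
  Cholesky elimination of the last variable. If the pivot vanishes then so does its row, and the
  convention \<open>x / 0 = 0\<close> lets the same formulas cover that case.
\<close>

lemma pos_form_sum_rank_one:
  fixes a :: "nat \<Rightarrow> nat \<Rightarrow> complex"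
  assumes "\<And>i j. i < n \<Longrightarrow> j < n \<Longrightarrow> a i j = cnj (a j i)"
    and "\<And>v. 0 \<le> Re (\<Sum>i<n. \<Sum>j<n. cnj (v i) * a i j * v j)"
  shows "\<exists>V. \<forall>i<n. \<forall>j<n. a i j = (\<Sum>k<n. V k i * cnj (V k j))"
  using assms
proof (induction n arbitrary: a)
  case (Suc n)
  note herm = Suc.prems(1) and pos = Suc.prems(2)
  define d where "d = Re (a n n)"
  have cnj: "cnj (a j i) = a i j" if "i < Suc n" "j < Suc n" for i j
    using herm[OF that] by simp
  have "Im (a n n) = 0" using arg_cong[OF herm[of n n], of Im] by simp
  then have ann: "a n n = complex_of_real d" by (simp add: d_def complex_eq_iff)
  have d0: "0 \<le> d"
    using pos[of "\<lambda>j. if j = n then 1 else 0"] unfolding qform_expand_last by (simp add: d_def)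
  have cancel: "a i n * complex_of_real d / complex_of_real d = a i n" if "i < n" for i
  proof (cases "d = 0")
    case True
    then show ?thesis using pos_form_off_diag_zero[OF herm pos _ that] ann by simp
  qed simp
  \<comment> \<open>This is the Schur complement of the pivot, the form left after the
    elimination.\<close>
  define b where "b i j = a i j - a i n * a n j / complex_of_real d" for i j
  have "\<exists>V. \<forall>i<n. \<forall>j<n. b i j = (\<Sum>k<n. V k i * cnj (V k j))"
  proof (rule Suc.IH)
    fix i j assume "i < n" "j < n"
    then show "b i j = cnj (b j i)" by (simp add: b_def cnj mult.commute)
  next
    fix v :: "nat \<Rightarrow> complex"
    define S where "S = (\<Sum>j<n. a n j * v j)"
    \<comment> \<open>Completing the square: for a nonzero pivot this last coordinate minimises the
      form of \<open>a\<close> over all extensions of \<open>v\<close>, and the minimum is the form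
      of \<open>b\<close> at \<open>v\<close>. So positivity passes to \<open>b\<close>.\<close>
    define w where "w = v(n := - S / complex_of_real d)"
    have S': "(\<Sum>i<n. cnj (v i) * a i n) = cnj S"
      unfolding S_def cnj_sum by (intro sum.cong) (auto simp: cnj mult.commute)
    have "(\<Sum>i<Suc n. \<Sum>j<Suc n. cnj (w i) * a i j * w j) =
        (\<Sum>i<n. \<Sum>j<n. cnj (v i) * a i j * v j) + cnj S * w n + cnj (w n) * S + cnj (w n) * a n n * w n"
      unfolding qform_expand_last using S' by (simp add: w_def S_def[symmetric])
    also have "\<dots> = (\<Sum>i<n. \<Sum>j<n. cnj (v i) * a i j * v j) - cnj S * S / complex_of_real d"
      by (cases "d = 0") (simp_all add: w_def ann field_simps)
    also have "\<dots> = (\<Sum>i<n. \<Sum>j<n. cnj (v i) * a i j * v j) -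
        (\<Sum>i<n. \<Sum>j<n. cnj (v i) * (a i n * a n j / complex_of_real d) * v j)"
      unfolding S'[symmetric] unfolding S_def sum_product
      by (simp add: sum_divide_distrib mult.assoc)
    also have "\<dots> = (\<Sum>i<n. \<Sum>j<n. cnj (v i) * b i j * v j)"
      by (simp add: b_def sum_subtractf[symmetric] algebra_simps)
    finally show "0 \<le> Re (\<Sum>i<n. \<Sum>j<n. cnj (v i) * b i j * v j)" using pos[of w] by simp
  qed
  then obtain V where V: "\<And>i j. i < n \<Longrightarrow> j < n \<Longrightarrow> b i j = (\<Sum>k<n. V k i * cnj (V k j))" by blast
  \<comment> \<open>The vectors obtained for \<open>b\<close> are extended by zero. The new one is
    the last column divided by the root of the pivot, and it restores what \<open>b\<close>
    subtracted.\<close>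
  define W where "W k i = (if k = n then a i n / complex_of_real (sqrt d) else if i = n then 0 else V k i)" for k i
  have sq: "complex_of_real (sqrt d) * complex_of_real (sqrt d) = complex_of_real d"
    using d0 by (simp flip: of_real_mult)
  have "a i j = (\<Sum>k<Suc n. W k i * cnj (W k j))" if ij: "i < Suc n" "j < Suc n" for i j
  proof -
    have jn: "cnj (a j n) = a n j" using cnj[of n j] ij by simp
    have "(\<Sum>k<Suc n. W k i * cnj (W k j)) =
        (\<Sum>k<n. if i = n \<or> j = n then 0 else V k i * cnj (V k j)) + a i n * a n j / complex_of_real d"
      by (cases "i = n"; cases "j = n") (simp_all add: W_def jn sq ann)
    also have "(\<Sum>k<n. if i = n \<or> j = n then 0 else V k i * cnj (V k j)) =
        (if i = n \<or> j = n then 0 else b i j)"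
      using V[of i j] ij by auto
    also have "\<dots> + a i n * a n j / complex_of_real d = a i j"
    proof -
      have cancel': "a n j' * complex_of_real d / complex_of_real d = a n j'" if "j' < n" for j'
        using arg_cong[OF cancel[OF that], of cnj] that by (auto simp: cnj split: if_splits)
      consider "i \<noteq> n" "j \<noteq> n" | "i = n" "j < n" | "i < n" "j = n" | "i = n" "j = n"
        using ij by linarith
      then show ?thesis
      proof cases
        case 1
        then show ?thesis by (simp add: b_def)
      next
        case 2
        then show ?thesis using cancel'[of j] by (simp only: ann mult.commute[of "complex_of_real d"]) simp
      next
        case 3
        then show ?thesis using cancel[of i] by (simp only: ann) simp
      next
        case 4
        then show ?thesis by (simp add: ann)
      qed
    qed
    finally show ?thesis by simp
  qed
  then show ?case by blast
qed simp

lemma psd_sum_rank_one: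
  assumes "psd N A"
  obtains V where "\<And>i j. i < N \<Longrightarrow> j < N \<Longrightarrow> A $$ (i, j) = (\<Sum>k<N. V k i * cnj (V k j))"
proof -
  have "\<exists>V. \<forall>i<N. \<forall>j<N. A $$ (i, j) = (\<Sum>k<N. V k i * cnj (V k j))"
    by (rule pos_form_sum_rank_one; use assms in \<open>unfold psd_def hermitian_def qform_def, blast\<close>)
  then show ?thesis using that by blast
qed

section \<open>Trace inequalities for positive semi-definite matrices\<close>

lemma mtrace_mult:
  assumes "A \<in> carrier_mat N N" "B \<in> carrier_mat N N"
  shows "mtrace (A * B) = (\<Sum>i<N. \<Sum>j<N. A $$ (i, j) * B $$ (j, i))"
  using assms unfolding mtrace_def
  by (auto simp: scalar_prod_def lessThan_atLeast0 intro!: sum.cong)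

lemma psd_carrier: "psd N A \<Longrightarrow> A \<in> carrier_mat N N"
  by (simp add: psd_def hermitian_def)

text \<open>Writing \<open>A\<close> as a sum of rank one matrices turns the trace into the sum of
  the quadratic form of \<open>B\<close> at the vectors \<open>V k\<close>.\<close>

lemma Re_mtrace_mult_nonneg:
  assumes A: "psd N A" and B: "psd N B"
  shows "0 \<le> Re (mtrace (A * B))"
proof -
  obtain V where V: "\<And>i j. i < N \<Longrightarrow> j < N \<Longrightarrow> A $$ (i, j) = (\<Sum>k<N. V k i * cnj (V k j))"
    using psd_sum_rank_one[OF A] by blast
  have "mtrace (A * B) = (\<Sum>j<N. \<Sum>i<N. A $$ (i, j) * B $$ (j, i))"
    unfolding mtrace_mult[OF A[THEN psd_carrier] B[THEN psd_carrier]] by (rule sum.swap)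
  also have "\<dots> = (\<Sum>j<N. \<Sum>i<N. \<Sum>k<N. cnj (V k j) * B $$ (j, i) * V k i)"
    by (intro sum.cong) (auto simp: V sum_distrib_left sum_distrib_right mult_ac)
  also have "\<dots> = (\<Sum>j<N. \<Sum>k<N. \<Sum>i<N. cnj (V k j) * B $$ (j, i) * V k i)"
    by (intro sum.cong sum.swap refl)
  also have "\<dots> = (\<Sum>k<N. qform N B (V k))"
    unfolding qform_def by (rule sum.swap)
  finally show ?thesis using B by (auto simp: psd_def intro!: sum_nonneg)
qed

text \<open>In the rank one decomposition an entry is a sum of products, each at most the squared
  norm of its vector since \<open>2 x y <= x^2 + y^2\<close>. These squared norms add up to the
  trace.\<close>

lemma psd_entry_le_mtrace:
  assumes A: "psd N A" and ij: "i < N" "j < N"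
  shows "cmod (A $$ (i, j)) \<le> Re (mtrace A)"
proof -
  obtain V where V: "\<And>i j. i < N \<Longrightarrow> j < N \<Longrightarrow> A $$ (i, j) = (\<Sum>k<N. V k i * cnj (V k j))"
    using psd_sum_rank_one[OF A] by blast
  have "cmod (A $$ (i, j)) \<le> (\<Sum>k<N. cmod (V k i) * cmod (V k j))"
    unfolding V[OF ij] by (rule order_trans[OF norm_sum]) (simp add: norm_mult)
  also have "\<dots> \<le> (\<Sum>k<N. \<Sum>l<N. (cmod (V k l))\<^sup>2)"
  proof (rule sum_mono)
    fix k
    have le: "(cmod (V k l))\<^sup>2 \<le> (\<Sum>l<N. (cmod (V k l))\<^sup>2)" if "l < N" for l
      by (rule member_le_sum) (use that in auto)
    have "2 * (cmod (V k i) * cmod (V k j)) \<le> (cmod (V k i))\<^sup>2 + (cmod (V k j))\<^sup>2"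
      using sum_squares_bound[of "cmod (V k i)" "cmod (V k j)"] by (simp add: mult.assoc)
    then show "cmod (V k i) * cmod (V k j) \<le> (\<Sum>l<N. (cmod (V k l))\<^sup>2)"
      using le[OF ij(1)] le[OF ij(2)] by linarith
  qed
  also have "\<dots> = (\<Sum>l<N. \<Sum>k<N. (cmod (V k l))\<^sup>2)" by (rule sum.swap)
  also have "\<dots> = Re (mtrace A)"
  proof -
    have "Re (V k l * cnj (V k l)) = (cmod (V k l))\<^sup>2" for k l
      by (simp add: complex_mult_cnj cmod_power2)
    then have "Re (A $$ (l, l)) = (\<Sum>k<N. (cmod (V k l))\<^sup>2)" if "l < N" for l
      by (simp only: V[OF that that] Re_sum)
    then show ?thesis using psd_carrier[OF A] by (auto simp: mtrace_def intro!: sum.cong)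
  qed
  finally show ?thesis .
qed

lemma psd_diag_nonneg:
  assumes A: "psd N A" and i: "i < N"
  shows "0 \<le> Re (A $$ (i, i))"
proof -
  obtain V where "\<And>i j. i < N \<Longrightarrow> j < N \<Longrightarrow> A $$ (i, j) = (\<Sum>k<N. V k i * cnj (V k j))"
    using psd_sum_rank_one[OF A] by blast
  then show ?thesis using i by (simp add: complex_mult_cnj sum_nonneg)
qed

text \<open>Entries of \<open>\<rho>\<close> are at most \<open>1\<close> and those of
  \<open>B\<close> at most its trace, and the trace of the product has \<open>N ^ 2\<close> terms.
  The estimate is crude, but its constant does not depend on \<open>\<rho>\<close>.\<close>

lemma Re_mtrace_density_mult_le:
  assumes \<rho>: "density_matrix N \<rho>" and B: "psd N B"
  shows "Re (mtrace (\<rho> * B)) \<le> real N ^ 2 * Re (mtrace B)"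
proof -
  have psd: "psd N \<rho>" and tr: "mtrace \<rho> = 1" using \<rho> by (auto simp: density_matrix_def)
  have "Re (mtrace (\<rho> * B)) \<le> cmod (mtrace (\<rho> * B))" by (rule complex_Re_le_cmod)
  also have "\<dots> \<le> (\<Sum>i<N. \<Sum>j<N. cmod (\<rho> $$ (i, j) * B $$ (j, i)))"
    unfolding mtrace_mult[OF psd[THEN psd_carrier] B[THEN psd_carrier]]
    by (intro order_trans[OF norm_sum] sum_mono norm_sum)
  also have "\<dots> \<le> (\<Sum>i<N. \<Sum>j<N. 1 * Re (mtrace B))"
  proof (intro sum_mono)
    fix i j assume ij: "i \<in> {..<N}" "j \<in> {..<N}"
    have "cmod (\<rho> $$ (i, j)) \<le> 1" using psd_entry_le_mtrace[OF psd, of i j] ij tr by simp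
    moreover have "cmod (B $$ (j, i)) \<le> Re (mtrace B)" using psd_entry_le_mtrace[OF B, of j i] ij by simp
    ultimately show "cmod (\<rho> $$ (i, j) * B $$ (j, i)) \<le> 1 * Re (mtrace B)"
      unfolding norm_mult by (intro mult_mono) auto
  qed
  finally show ?thesis by (simp add: power2_eq_square)
qed

section \<open>Algorithmic probability\<close>

text \<open>Induction on the maximal length, splitting by the first letter: each half is again
  prefix-free and loses one letter, so it contributes at most one half. If the empty string occurs,
  it is the only element.\<close>

lemma kraft_inequality:
  fixes F :: "bstring set"
  assumes "finite F" "\<And>p q. p \<in> F \<Longrightarrow> q \<in> F \<Longrightarrow> prefix p q \<Longrightarrow> p = q"
  shows "(\<Sum>p\<in>F. (1 / 2 :: real) ^ length p) \<le> 1"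
proof -
  obtain L where "\<forall>p\<in>F. length p \<le> L"
    using finite_nat_set_iff_bounded_le[of "length ` F"] assms(1) by auto
  then show ?thesis
    using assms
  proof (induction L arbitrary: F)
    case 0
    have "(\<Sum>p\<in>F. (1 / 2 :: real) ^ length p) \<le> (\<Sum>p\<in>{[] :: bstring}. (1 / 2) ^ length p)"
      by (rule sum_mono2) (use 0 in auto)
    then show ?case by simp
  next
    case (Suc L)
    show ?case
    proof (cases "[] \<in> F")
      case True
      have F: "F \<subseteq> {[]}"
      proof
        fix q assume "q \<in> F"
        then have "[] = q" using Suc.prems(3)[OF True] by simp
        then show "q \<in> {[]}" by simp
      qed
      have "(\<Sum>p\<in>F. (1 / 2 :: real) ^ length p) \<le> (\<Sum>p\<in>{[] :: bstring}. (1 / 2) ^ length p)"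
        by (rule sum_mono2) (use F in auto)
      then show ?thesis by simp
    next
      case False
      define G where "G b = {p. b # p \<in> F}" for b
      have fin: "finite (G b)" for b
        using finite_vimageI[OF Suc.prems(2), of "Cons b"] by (simp add: G_def vimage_def)
      have le: "(\<Sum>p\<in>G b. (1 / 2 :: real) ^ length p) \<le> 1" for b
      proof (rule Suc.IH[OF _ fin])
        show "\<forall>p\<in>G b. length p \<le> L" using Suc.prems(1) by (fastforce simp: G_def)
        show "p = q" if "p \<in> G b" "q \<in> G b" "prefix p q" for p q
          using Suc.prems(3)[of "b # p" "b # q"] that by (simp add: G_def)
      qed
      have F: "F = Cons True ` G True \<union> Cons False ` G False"
      proof
        show "F \<subseteq> Cons True ` G True \<union> Cons False ` G False"
        proof
          fix p assume p: "p \<in> F"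
          then obtain b q where bq: "p = b # q" using False by (cases p) auto
          then show "p \<in> Cons True ` G True \<union> Cons False ` G False"
            using p by (cases b) (auto simp: G_def)
        qed
      qed (auto simp: G_def)
      have half: "(\<Sum>p\<in>Cons b ` G b. (1 / 2 :: real) ^ length p) \<le> 1 / 2" for b
        using le[of b] by (simp add: sum.reindex sum_divide_distrib[symmetric])
      have "(\<Sum>p\<in>F. (1 / 2 :: real) ^ length p) =
          (\<Sum>p\<in>Cons True ` G True. (1 / 2) ^ length p) + (\<Sum>p\<in>Cons False ` G False. (1 / 2) ^ length p)"
        unfolding F by (rule sum.union_disjoint) (auto simp: fin)
      then show ?thesis using half[of True] half[of False] by linarith
    qed
  qed
qed

lemma computer_kraft:
  assumes "computer U" "finite F" "F \<subseteq> dom U"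
  shows "(\<Sum>p\<in>F. (1 / 2 :: real) ^ length p) \<le> 1"
proof (rule kraft_inequality)
  fix p q assume "p \<in> F" "q \<in> F" "prefix p q"
  then show "p = q" using assms(1,3) unfolding computer_def by blast
qed fact

lemma computer_summable:
  assumes "computer U" "A \<subseteq> dom U"
  shows "(\<lambda>p. (1 / 2 :: real) ^ length p) summable_on A"
proof (rule nonneg_bdd_above_summable_on)
  show "bdd_above (sum (\<lambda>p. (1 / 2 :: real) ^ length p) ` {F. F \<subseteq> A \<and> finite F})"
    by (rule bdd_aboveI2[of _ _ 1]) (use computer_kraft[OF assms(1)] assms(2) in blast)
qed simp

lemma computer_infsum_le_1:
  assumes "computer U" "A \<subseteq> dom U"
  shows "infsum (\<lambda>p. (1 / 2 :: real) ^ length p) A \<le> 1"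
  by (rule infsum_le_finite_sums[OF computer_summable[OF assms]])
     (use computer_kraft[OF assms(1)] assms(2) in blast)

lemma Pc_nonneg: "0 \<le> Pc U s"
  unfolding Pc_def by (rule infsum_nonneg) simp

lemma sum_le_Pc:
  assumes "computer U" "finite F" "F \<subseteq> {p. U p = Some s}"
  shows "(\<Sum>p\<in>F. (1 / 2) ^ length p) \<le> Pc U s"
  unfolding Pc_def using assms
  by (intro finite_sum_le_infsum computer_summable[of U]) auto

text \<open>Programs with different outputs are different, so the sum is the mass of a single subset
  of the domain of \<open>U\<close>.\<close>

lemma sum_Pc_le_1:
  assumes U: "computer U" and S: "finite S"
  shows "(\<Sum>s\<in>S. Pc U s) \<le> 1"
proof -
  have "(\<Sum>s\<in>S. Pc U s) = infsum (\<lambda>p. (1 / 2) ^ length p) (\<Union>s\<in>S. {p. U p = Some s})"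
    using S
  proof (induction S rule: finite_induct)
    case (insert s S)
    have "infsum (\<lambda>p. (1 / 2 :: real) ^ length p) ({p. U p = Some s} \<union> (\<Union>s\<in>S. {p. U p = Some s})) =
        infsum (\<lambda>p. (1 / 2) ^ length p) {p. U p = Some s} +
        infsum (\<lambda>p. (1 / 2) ^ length p) (\<Union>s\<in>S. {p. U p = Some s})"
      by (intro infsum_Un_disjoint computer_summable[OF U]) (use insert.hyps in auto)
    then show ?case using insert by (simp add: Pc_def)
  qed simp
  also have "\<dots> \<le> 1" by (rule computer_infsum_le_1[OF U]) auto
  finally show ?thesis .
qed

text \<open>Simulating this computer gives the optimal one a program for \<open>s\<close>, so that
  \<open>Kc\<close> is a genuine minimum for every string.\<close>

lemma computer_single: "computer (\<lambda>p. if p = [] then Some s else None)"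
  unfolding computer_def
proof (intro conjI allI impI)
  \<comment> \<open>The condition does not mention the search variable: the search stops at once on
    code \<open>0\<close>, the empty string, and otherwise never.\<close>
  have "decidable_rec (Suc 1) (\<lambda>xs. xs ! 1 = 0)"
    by (intro decidable_rec_eq total_rec_nth total_rec_const) simp
  from exists_recf_search[where h = "\<lambda>i. str_code s", OF this total_rec_const] obtain r where
    "\<forall>xs y. length xs = 1 \<longrightarrow> (evalr r xs y \<longleftrightarrow> (\<exists>i. (i # xs) ! 1 = 0 \<and>
      (\<forall>m<i. \<not> (m # xs) ! 1 = 0) \<and> y = str_code s))" ..
  then have r: "evalr r [x] y \<longleftrightarrow> (\<exists>i::nat. x = 0 \<and> (\<forall>m<i. x \<noteq> 0) \<and> y = str_code s)" for x y
    by simp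
  have "str_code p = 0 \<longleftrightarrow> p = []" for p using str_code_inject[of p "[]"] by simp
  then have "evalr r [str_code p] y \<longleftrightarrow> (\<exists>t. (if p = [] then Some s else None) = Some t \<and> y = str_code t)" for p y
    unfolding r by auto
  then show "partial_recursive_str (\<lambda>p. if p = [] then Some s else None)"
    unfolding partial_recursive_str_def by blast
qed (auto split: if_splits)

text \<open>A shortest program for \<open>s\<close> is one of the summands of
  \<open>P(s)\<close>.\<close>

lemma Kc_le_Pc:
  assumes "optimal_computer U"
  shows "(1 / 2) ^ Kc U s \<le> Pc U s"
proof -
  have U: "computer U" using assms by (simp add: optimal_computer_def)
  have sim: "\<forall>C. computer C \<longrightarrow> (\<exists>d::nat. \<forall>p t. C p = Some t \<longrightarrow>
      (\<exists>p'. U p' = Some t \<and> length p' \<le> length p + d))"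
    using assms unfolding optimal_computer_def by (rule conjunct2)
  obtain d where "\<forall>(p :: bstring) t. (if p = [] then Some s else None) = Some t \<longrightarrow>
      (\<exists>p'. U p' = Some t \<and> length p' \<le> length p + d)"
    using sim[rule_format, OF computer_single[of s]] ..
  from this[rule_format, of "[]" s] have "\<exists>p'. U p' = Some s \<and> length p' \<le> d" by simp
  then obtain q where "U q = Some s" by blast
  then have "\<exists>p. U p = Some s \<and> length p = Kc U s"
    unfolding Kc_def by (intro LeastI_ex[of "\<lambda>n. \<exists>p. U p = Some s \<and> length p = n"]) blast
  then obtain p where "U p = Some s" "length p = Kc U s" by blast
  then show ?thesis using sum_le_Pc[OF U, of "{p}" s] by simp
qed

section \<open>Approximating \<open>P\<close> from below by halting programs\<close>

lemma rat_code_prod_encode: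
  "rat_code (prod_encode (prod_encode (a, b), d)) = (real a - real b) / (real d + 1)"
  by (simp add: rat_code_def)

lemma rat_code_0: "rat_code 0 = 0"
  using rat_code_prod_encode[of 0 0 0] by (simp add: prod_encode_def)

text \<open>
  The programs with code below \<open>n\<close> that produce \<open>x\<close> within bound \<open>n\<close> have mass
  \<open>halting_num r n x / 2 ^ n\<close>.
\<close>

definition halting_num :: "recf \<Rightarrow> nat \<Rightarrow> nat \<Rightarrow> nat" where
  "halting_num r n x = (\<Sum>z<n. if step_eval r n [z] = Suc x then 2 ^ (n - code_length z) else 0)"

text \<open>\<open>rat_code\<close> divides by its last component plus one, hence
  \<open>2 ^ n - 1\<close> for the denominator \<open>2 ^ n\<close>.\<close>

definition halting_approx :: "recf \<Rightarrow> nat \<Rightarrow> nat \<Rightarrow> nat" where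
  "halting_approx r n x = prod_encode (prod_encode (halting_num r n x, 0), 2 ^ n - 1)"

lemma total_rec_halting_approx:
  assumes "total_rec n a" "total_rec n b"
  shows "total_rec n (\<lambda>xs. halting_approx r (a xs) (b xs))"
proof -
  have step: "total_rec k (\<lambda>xs. step_eval r (u xs) [v xs])" if u: "total_rec k u" and v: "total_rec k v" for k u v
  proof -
    have "total_rec k (\<lambda>xs. step_eval r ([u xs, v xs] ! 0) (tl [u xs, v xs]))"
    proof (rule total_rec_app_list[OF total_rec_step_eval[of 1]])
      fix i :: nat assume "i < Suc 1"
      then have "i = 0 \<or> i = 1" by auto
      then show "total_rec k (\<lambda>xs. [u xs, v xs] ! i)" using u v by auto
    qed simp
    then show ?thesis by simp
  qed
  have "total_rec 2 (\<lambda>xs. halting_approx r (xs ! 0) (xs ! 1))"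
    unfolding halting_approx_def halting_num_def
    by (intro total_rec_prod_encode total_rec_sum total_rec_if decidable_rec_eq step total_rec_power
        total_rec_diff total_rec_code_length total_rec_Suc total_rec_const
        total_rec_nth total_rec_tl[of 2 "\<lambda>xs. xs ! _"]) auto
  from total_rec_app2[OF this assms] show ?thesis .
qed

definition halted :: "recf \<Rightarrow> nat \<Rightarrow> bstring \<Rightarrow> bstring set" where
  "halted r n s = {p. str_code p < n \<and> step_eval r n [str_code p] = Suc (str_code s)}"

lemma finite_halted: "finite (halted r n s)"
proof (rule finite_subset)
  show "halted r n s \<subseteq> str_decode ` {..<n}"
    by (auto simp: halted_def image_iff intro!: bexI[of _ "str_code _"])
qed simp

lemma rat_code_halting_approx:
  "rat_code (halting_approx r n (str_code s)) = (\<Sum>p\<in>halted r n s. (1 / 2) ^ length p)"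
proof -
  let ?Z = "{z \<in> {..<n}. step_eval r n [z] = Suc (str_code s)}"
  have "real (halting_num r n (str_code s)) = (\<Sum>z\<in>?Z. real (2 ^ (n - code_length z)))"
    unfolding halting_num_def by (subst sum.inter_filter[symmetric]) (simp_all del: of_nat_power)
  also have "\<dots> = (\<Sum>p\<in>halted r n s. real (2 ^ (n - length p)))"
    by (rule sum.reindex_bij_witness[of _ str_code str_decode])
       (auto simp: halted_def simp flip: code_length_str_code)
  also have "\<dots> = (\<Sum>p\<in>halted r n s. 2 ^ n * (1 / 2) ^ length p)"
  proof (rule sum.cong[OF refl])
    fix p assume "p \<in> halted r n s"
    then have "length p \<le> n" using length_le_str_code[of p] by (simp add: halted_def)
    then show "real (2 ^ (n - length p)) = 2 ^ n * (1 / 2) ^ length p" by (rule real_two_power_diff)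
  qed
  finally have "real (halting_num r n (str_code s)) = 2 ^ n * (\<Sum>p\<in>halted r n s. (1 / 2) ^ length p)"
    by (simp add: sum_distrib_left)
  moreover have "real (2 ^ n - 1) + 1 = 2 ^ n" by (simp add: of_nat_diff)
  ultimately show ?thesis
    unfolding halting_approx_def rat_code_prod_encode by (simp del: of_nat_diff)
qed

lemma halted_subset:
  assumes "\<And>p y. evalr r [str_code p] y \<longleftrightarrow> (\<exists>t. U p = Some t \<and> y = str_code t)"
  shows "halted r n s \<subseteq> {p. U p = Some s}"
proof
  fix p assume "p \<in> halted r n s"
  then have "evalr r [str_code p] (str_code s)" by (auto simp: halted_def intro: step_eval_sound)
  then show "p \<in> {p. U p = Some s}" using assms by (auto simp: str_code_inject)
qed

text \<open>Every finite set of programs for \<open>s\<close> is eventually contained in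
  \<open>halted r n s\<close>, so these sets run through the filter of finite subsets along which
  the infinite sum is defined.\<close>

lemma halting_approx_tendsto:
  assumes U: "computer U"
    and r: "\<And>p y. evalr r [str_code p] y \<longleftrightarrow> (\<exists>t. U p = Some t \<and> y = str_code t)"
  shows "(\<lambda>n. rat_code (halting_approx r n (str_code s))) \<longlonglongrightarrow> Pc U s"
proof -
  let ?A = "{p. U p = Some s}"
  have "filterlim (\<lambda>n. halted r n s) (finite_subsets_at_top ?A) sequentially"
    unfolding filterlim_finite_subsets_at_top
  proof (intro allI impI)
    fix X assume X: "finite X \<and> X \<subseteq> ?A"
    have "\<forall>\<^sub>F n in sequentially. p \<in> halted r n s" if "p \<in> X" for p
    proof -
      have "evalr r [str_code p] (str_code s)" using X that r by auto
      from step_eval_complete[OF this] eventually_gt_at_top[of "str_code p"] show ?thesis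
        by eventually_elim (simp add: halted_def)
    qed
    then have "\<forall>\<^sub>F n in sequentially. \<forall>p\<in>X. p \<in> halted r n s"
      using X by (intro eventually_ball_finite) auto
    then show "\<forall>\<^sub>F n in sequentially. finite (halted r n s) \<and> X \<subseteq> halted r n s \<and> halted r n s \<subseteq> ?A"
      by eventually_elim (use finite_halted halted_subset[OF r] in blast)
  qed
  moreover have "((\<lambda>p. (1 / 2 :: real) ^ length p) has_sum Pc U s) ?A"
    unfolding Pc_def by (intro has_sum_infsum computer_summable[OF U]) auto
  ultimately show ?thesis
    unfolding has_sum_def rat_code_halting_approx by (rule filterlim_compose[rotated])
qed

section \<open>The semi-POVM \<open>P(s) I\<close>\<close>

abbreviation scalar_mat :: "nat \<Rightarrow> real \<Rightarrow> complex mat" where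
  "scalar_mat N c \<equiv> complex_of_real c \<cdot>\<^sub>m 1\<^sub>m N"

lemma hermitian_scalar_mat: "hermitian N (scalar_mat N c)"
  by (auto simp: hermitian_def)

lemma psd_scalar_mat:
  assumes "0 \<le> c"
  shows "psd N (scalar_mat N c)"
proof -
  have "qform N (scalar_mat N c) v = complex_of_real (\<Sum>i<N. c * (cmod (v i))\<^sup>2)" for v
  proof -
    have "(\<Sum>j<N. cnj (v i) * scalar_mat N c $$ (i, j) * v j) = complex_of_real (c * (cmod (v i))\<^sup>2)"
      if i: "i < N" for i
    proof -
      have "(\<Sum>j<N. cnj (v i) * scalar_mat N c $$ (i, j) * v j) =
          (\<Sum>j\<in>{i}. cnj (v i) * scalar_mat N c $$ (i, j) * v j)"
        by (rule sum.mono_neutral_right) (use i in auto)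
      also have "\<dots> = complex_of_real c * (v i * cnj (v i))" using i by simp
      also have "\<dots> = complex_of_real (c * (cmod (v i))\<^sup>2)"
        by (simp add: complex_mult_cnj cmod_power2)
      finally show ?thesis .
    qed
    then show ?thesis unfolding qform_def by simp
  qed
  moreover have "0 \<le> (\<Sum>i<N. c * (cmod (v i))\<^sup>2)" for v :: "nat \<Rightarrow> complex"
    using assms by (intro sum_nonneg) auto
  ultimately show ?thesis by (simp add: psd_def hermitian_scalar_mat)
qed

lemma loewner_le_scalar_mat: "a \<le> b \<Longrightarrow> loewner_le N (scalar_mat N a) (scalar_mat N b)"
proof -
  assume "a \<le> b"
  moreover have "scalar_mat N b - scalar_mat N a = scalar_mat N (b - a)"
    by (rule eq_matI) auto
  ultimately show ?thesis
    using psd_scalar_mat[of "b - a" N] by (simp add: loewner_le_def hermitian_scalar_mat)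
qed

lemma lower_computable_semi_POVM_Pc:
  assumes U: "computer U"
  shows "lower_computable_semi_POVM N (\<lambda>s. scalar_mat N (Pc U s))"
  unfolding lower_computable_semi_POVM_def
proof (intro conjI)
  have msum: "msum N (\<lambda>s. scalar_mat N (Pc U s)) S = scalar_mat N (\<Sum>s\<in>S. Pc U s)" for S
    by (rule eq_matI) (auto simp: msum_def)
  have one: "scalar_mat N 1 = 1\<^sub>m N" by (rule eq_matI) auto
  show "semi_POVM N (\<lambda>s. scalar_mat N (Pc U s))"
    unfolding semi_POVM_def msum
    using psd_scalar_mat[OF Pc_nonneg] loewner_le_scalar_mat[OF sum_Pc_le_1[OF U], of _ N]
    unfolding one by blast
  obtain r where r: "\<And>p y. evalr r [str_code p] y \<longleftrightarrow> (\<exists>t. U p = Some t \<and> y = str_code t)"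
    using U unfolding computer_def partial_recursive_str_def by blast
  define q where "q n s = rat_code (halting_approx r n (str_code s))" for n s
  define f where "f n s = scalar_mat N (q n s)" for n s
  have q_le: "q n s \<le> Pc U s" for n s
    unfolding q_def rat_code_halting_approx
    by (rule sum_le_Pc[OF U finite_halted halted_subset[OF r]])
  \<comment> \<open>The five arguments are the stage, the code of \<open>s\<close>, row, column, and
    a selector that is \<open>0\<close> for the real and \<open>1\<close> for the imaginary part.
    Off-diagonal entries and imaginary parts receive the number \<open>0\<close>, which codes the
    rational zero.\<close>
  have "total_rec 5 (\<lambda>xs. if xs ! 2 = xs ! 3 \<and> xs ! 4 = 0 then halting_approx r (xs ! 0) (xs ! 1) else 0)"
    by (intro total_rec_if decidable_rec_conj decidable_rec_eq total_rec_halting_approx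
        total_rec_const total_rec_nth) auto
  then obtain R where R: "\<And>xs. length xs = 5 \<Longrightarrow>
      evalr R xs (if xs ! 2 = xs ! 3 \<and> xs ! 4 = 0 then halting_approx r (xs ! 0) (xs ! 1) else 0)"
    unfolding total_rec_def by blast
  have ev: "evalr R [n, x, i, j, b] (if i = j \<and> b = 0 then halting_approx r n x else 0)" for n x i j b
    using R[of "[n, x, i, j, b]"] by (cases "i = j \<and> b = 0") auto
  have rat: "q n s \<in> \<rat>" for n s
    unfolding q_def halting_approx_def rat_code_prod_encode by (intro Rats_divide Rats_diff Rats_add Rats_of_nat Rats_1)
  have tot: "total_recursive_HerQ N f"
    unfolding total_recursive_HerQ_def
  proof (intro conjI exI[of _ R] allI impI)
    fix n s
    show "herm_Q N (f n s)"
      unfolding herm_Q_def f_def using rat by (auto simp: hermitian_scalar_mat is_rat_complex_def)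
  next
    fix n s i j assume ij: "i < N" "j < N"
    show "\<exists>y z. evalr R [n, str_code s, i, j, 0] y \<and> evalr R [n, str_code s, i, j, 1] z \<and>
        f n s $$ (i, j) = Complex (rat_code y) (rat_code z)"
    proof (intro exI conjI)
      show "evalr R [n, str_code s, i, j, 0] (if i = j then halting_approx r n (str_code s) else 0)"
        using ev[of n "str_code s" i j 0] by simp
      show "evalr R [n, str_code s, i, j, 1] 0" using ev[of n "str_code s" i j 1] by simp
      show "f n s $$ (i, j) = Complex (rat_code (if i = j then halting_approx r n (str_code s) else 0)) (rat_code 0)"
        using ij by (simp add: f_def q_def rat_code_0 complex_eq_iff)
    qed
  qed
  have lim: "(\<lambda>n. f n s $$ (i, j)) \<longlonglongrightarrow> scalar_mat N (Pc U s) $$ (i, j)" if "i < N" "j < N" for s i j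
    using tendsto_of_real[OF halting_approx_tendsto[OF U r, of s], where 'a = complex] that
    by (simp add: f_def q_def)
  show "\<exists>f. total_recursive_HerQ N f \<and>
      (\<forall>s. \<forall>i<N. \<forall>j<N. (\<lambda>n. f n s $$ (i, j)) \<longlonglongrightarrow> scalar_mat N (Pc U s) $$ (i, j)) \<and>
      (\<forall>n s. loewner_le N (f n s) (scalar_mat N (Pc U s)))"
    using tot lim loewner_le_scalar_mat[OF q_le] unfolding f_def by blast
qed

section \<open>Diagonal semimeasures and the bounds on the trace\<close>

lemma total_rec_fix_args:
  assumes "\<And>n x. evalr r ([n, x] @ cs) (F n x)"
  shows "total_rec 2 (\<lambda>xs. F (xs ! 0) (xs ! 1))"
proof -
  have "\<exists>k. \<forall>xs. length xs = 2 \<longrightarrow> evalr k xs c" for c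
    using total_rec_const[of 2 c] by (simp add: total_rec_def)
  then obtain k where k: "\<And>c xs. length xs = 2 \<Longrightarrow> evalr (k c) xs c" by metis
  \<comment> \<open>\<open>r\<close> is only assumed to halt when its last arguments are
    \<open>cs\<close>, whereas \<open>total_rec_comp\<close> asks for totality on all lists of the
    right length. The composition is therefore built by hand.\<close>
  have "evalr (Comp r ([Proj 0, Proj 1] @ map k cs)) [n, x] (F n x)" for n x
  proof (rule evalr.comp[OF _ assms])
    have "list_all2 (\<lambda>g y. evalr g [n, x] y) (map k cs) cs"
      using k[of "[n, x]"] by (auto simp: list_all2_conv_all_nth)
    moreover have "evalr (Proj 0) [n, x] n" "evalr (Proj 1) [n, x] x"
      using evalr.proj[of 0 "[n, x]"] evalr.proj[of 1 "[n, x]"] by auto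
    ultimately show "list_all2 (\<lambda>g y. evalr g [n, x] y) ([Proj 0, Proj 1] @ map k cs) ([n, x] @ cs)"
      by simp
  qed
  moreover have "xs = [xs ! 0, xs ! 1]" if "length xs = 2" for xs :: "nat list"
    using that by (auto simp: numeral_2_eq_2 length_Suc_conv)
  ultimately show ?thesis unfolding total_rec_def by metis
qed

text \<open>Limits pass to the entries, and so do the Loewner inequalities on the diagonal, because
  a positive semi-definite difference has a nonnegative diagonal.\<close>

lemma diag_semimeasure:
  assumes M: "lower_computable_semi_POVM N M" and i: "i < N"
  shows "\<exists>F. lower_computable_semimeasure F (\<lambda>s. Re (M s $$ (i, i)))"
proof -
  from M have povm: "semi_POVM N M" by (simp add: lower_computable_semi_POVM_def)
  from M obtain f where tot: "total_recursive_HerQ N f"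
    and lim: "\<forall>s. \<forall>i<N. \<forall>j<N. (\<lambda>n. f n s $$ (i, j)) \<longlonglongrightarrow> M s $$ (i, j)"
    and le: "\<forall>n s. loewner_le N (f n s) (M s)"
    unfolding lower_computable_semi_POVM_def by blast
  from tot obtain r where r: "\<forall>n s i j. i < N \<longrightarrow> j < N \<longrightarrow>
        (\<exists>y z. evalr r [n, str_code s, i, j, 0] y \<and> evalr r [n, str_code s, i, j, 1] z \<and>
               f n s $$ (i, j) = Complex (rat_code y) (rat_code z))"
    unfolding total_recursive_HerQ_def by blast
  \<comment> \<open>Every number is the code of some string, so \<open>F\<close> can be chosen on
    all arguments as the actual output of \<open>r\<close>.\<close>
  have "\<exists>y. evalr r [n, x, i, i, 0] y \<and> rat_code y = Re (f n (str_decode x) $$ (i, i))" for n x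
    using r[rule_format, OF i i, of n "str_decode x"] by auto
  then obtain F where F: "\<And>n x. evalr r [n, x, i, i, 0] (F n x)"
    and Fval: "\<And>n x. rat_code (F n x) = Re (f n (str_decode x) $$ (i, i))"
    by metis
  have "lower_computable_semimeasure F (\<lambda>s. Re (M s $$ (i, i)))"
  proof
    show "total_rec 2 (\<lambda>xs. F (xs ! 0) (xs ! 1))"
      by (rule total_rec_fix_args[of r "[i, i, 0]"]) (simp add: F)
  next
    fix s
    have "(\<lambda>n. f n s $$ (i, i)) \<longlonglongrightarrow> M s $$ (i, i)" using lim i by blast
    from tendsto_Re[OF this] show "(\<lambda>n. rat_code (F n (str_code s))) \<longlonglongrightarrow> Re (M s $$ (i, i))"
      by (simp add: Fval)
  next
    fix n s
    have l: "loewner_le N (f n s) (M s)" using le by blast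
    then have "0 \<le> Re ((M s - f n s) $$ (i, i))"
      unfolding loewner_le_def using psd_diag_nonneg[OF _ i] by blast
    moreover have "f n s \<in> carrier_mat N N" using l by (simp add: loewner_le_def hermitian_def)
    ultimately show "rat_code (F n (str_code s)) \<le> Re (M s $$ (i, i))"
      using i by (simp add: Fval)
  next
    fix s
    show "0 \<le> Re (M s $$ (i, i))"
      using povm psd_diag_nonneg[OF _ i] by (simp add: semi_POVM_def)
  next
    fix S :: "bstring set" assume "finite S"
    then have "loewner_le N (msum N M S) (1\<^sub>m N)" using povm by (simp add: semi_POVM_def)
    then have "0 \<le> Re ((1\<^sub>m N - msum N M S) $$ (i, i))"
      unfolding loewner_le_def using psd_diag_nonneg[OF _ i] by blast
    then show "(\<Sum>s\<in>S. Re (M s $$ (i, i))) \<le> 1" using i by (simp add: msum_def)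
  qed
  then show ?thesis by blast
qed

text \<open>The entries are treated one at a time since each diagonal entry has total mass at most
  \<open>1\<close>, whereas for the trace the semi-POVM condition only gives the bound
  \<open>N\<close>.\<close>

lemma mtrace_le_Kc:
  assumes N: "0 < N" and U: "optimal_computer U" and M: "lower_computable_semi_POVM N M"
  shows "\<exists>c>0. \<forall>s. Re (mtrace (M s)) \<le> c * (1 / 2) ^ Kc U s"
proof -
  have "\<exists>c>0. \<forall>s. Re (M s $$ (i, i)) \<le> c * (1 / 2) ^ Kc U s" if "i < N" for i
    using diag_semimeasure[OF M that] lower_computable_semimeasure.Kc_upper_bound[OF _ U] by blast
  then obtain c where c: "\<And>i. i < N \<Longrightarrow> 0 < c i"
      "\<And>i s. i < N \<Longrightarrow> Re (M s $$ (i, i)) \<le> c i * (1 / 2) ^ Kc U s"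
    by metis
  have "Re (mtrace (M s)) \<le> (\<Sum>i<N. c i) * (1 / 2) ^ Kc U s" for s
  proof -
    have "M s \<in> carrier_mat N N"
      using M by (simp add: lower_computable_semi_POVM_def semi_POVM_def psd_carrier)
    then have "Re (mtrace (M s)) = (\<Sum>i<N. Re (M s $$ (i, i)))" by (simp add: mtrace_def)
    also have "\<dots> \<le> (\<Sum>i<N. c i * (1 / 2) ^ Kc U s)" by (intro sum_mono c(2)) simp
    finally show ?thesis by (simp add: sum_distrib_right)
  qed
  moreover have "0 < (\<Sum>i<N. c i)" using N c(1) by (intro sum_pos) auto
  ultimately show ?thesis by blast
qed

text \<open>The trace of \<open>\<rho>\<close> times the positive semi-definite difference is
  nonnegative, and trace one turns the scalar matrix into the number \<open>a\<close>.\<close>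

lemma Re_mtrace_density_mult_ge:
  assumes \<rho>: "density_matrix N \<rho>" and le: "loewner_le N (scalar_mat N a) A"
  shows "a \<le> Re (mtrace (\<rho> * A))"
proof -
  have psd: "psd N \<rho>" and tr: "mtrace \<rho> = 1" using \<rho> by (auto simp: density_matrix_def)
  have car: "\<rho> \<in> carrier_mat N N" "A \<in> carrier_mat N N"
    using psd le by (auto simp: psd_carrier loewner_le_def hermitian_def)
  have "mtrace (\<rho> * (A - scalar_mat N a)) =
      (\<Sum>i<N. \<Sum>j<N. \<rho> $$ (i, j) * (A $$ (j, i) - scalar_mat N a $$ (j, i)))"
    using car by (subst mtrace_mult[of _ N]) auto
  also have "\<dots> = (\<Sum>i<N. \<Sum>j<N. \<rho> $$ (i, j) * A $$ (j, i)) -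
      (\<Sum>i<N. \<Sum>j<N. \<rho> $$ (i, j) * scalar_mat N a $$ (j, i))"
    by (simp only: right_diff_distrib sum_subtractf)
  also have "(\<Sum>i<N. \<Sum>j<N. \<rho> $$ (i, j) * scalar_mat N a $$ (j, i)) =
      (\<Sum>i<N. \<rho> $$ (i, i) * complex_of_real a)"
  proof (rule sum.cong[OF refl])
    fix i assume i: "i \<in> {..<N}"
    have "(\<Sum>j<N. \<rho> $$ (i, j) * scalar_mat N a $$ (j, i)) =
        (\<Sum>j\<in>{i}. \<rho> $$ (i, j) * scalar_mat N a $$ (j, i))"
      by (rule sum.mono_neutral_right) (use i in auto)
    then show "(\<Sum>j<N. \<rho> $$ (i, j) * scalar_mat N a $$ (j, i)) = \<rho> $$ (i, i) * complex_of_real a"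
      using i by simp
  qed
  also have "\<dots> = mtrace \<rho> * complex_of_real a"
    using car by (simp add: mtrace_def sum_distrib_right)
  finally have "mtrace (\<rho> * (A - scalar_mat N a)) = mtrace (\<rho> * A) - complex_of_real a"
    by (simp add: tr mtrace_mult[OF car])
  moreover have "0 \<le> Re (mtrace (\<rho> * (A - scalar_mat N a)))"
    using le by (intro Re_mtrace_mult_nonneg[OF psd]) (simp add: loewner_le_def)
  ultimately show ?thesis by simp
qed

theorem mainTheorem9:
  fixes N :: nat and U :: "bstring \<Rightarrow> bstring option" and M :: "bstring \<Rightarrow> complex mat"
  assumes "0 < N"
    and "optimal_computer U"
    and "universal_semi_POVM N M"
  shows "\<exists>c \<ge> 0. \<exists>c' > 0. \<forall>\<rho> s. density_matrix N \<rho> \<longrightarrow>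
           \<bar>real (Kc U s) + log 2 (Re (mtrace (\<rho> * M s)))\<bar> \<le> c \<and>
           c' * Pc U s \<le> Re (mtrace (\<rho> * M s)) \<and>
           c' * Re (mtrace (\<rho> * M s)) \<le> Pc U s"
proof -
  have U: "computer U" using assms(2) by (simp add: optimal_computer_def)
  have M: "lower_computable_semi_POVM N M" using assms(3) by (simp add: universal_semi_POVM_def)
  obtain a where a: "0 < a" "\<And>s. loewner_le N (complex_of_real a \<cdot>\<^sub>m scalar_mat N (Pc U s)) (M s)"
    using assms(3) lower_computable_semi_POVM_Pc[OF U, of N] unfolding universal_semi_POVM_def by blast
  have smult: "complex_of_real a \<cdot>\<^sub>m scalar_mat N x = scalar_mat N (a * x)" for x
    by (rule eq_matI) auto
  obtain b where b: "0 < b" "\<And>s. Re (mtrace (M s)) \<le> b * (1 / 2) ^ Kc U s"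
    using mtrace_le_Kc[OF assms(1,2) M] by blast
  define B where "B = real N ^ 2 * b"
  have B: "0 < B" using assms(1) b(1) by (simp add: B_def)
  have bounds: "a * Pc U s \<le> Re (mtrace (\<rho> * M s))" "Re (mtrace (\<rho> * M s)) \<le> B * (1 / 2) ^ Kc U s"
    if \<rho>: "density_matrix N \<rho>" for \<rho> s
  proof -
    show "a * Pc U s \<le> Re (mtrace (\<rho> * M s))"
      using Re_mtrace_density_mult_ge[OF \<rho>] a(2)[of s] unfolding smult by blast
    have "psd N (M s)" using M by (simp add: lower_computable_semi_POVM_def semi_POVM_def)
    then have "Re (mtrace (\<rho> * M s)) \<le> real N ^ 2 * Re (mtrace (M s))"
      by (rule Re_mtrace_density_mult_le[OF \<rho>])
    also have "\<dots> \<le> real N ^ 2 * (b * (1 / 2) ^ Kc U s)" by (intro mult_left_mono b(2)) simp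
    finally show "Re (mtrace (\<rho> * M s)) \<le> B * (1 / 2) ^ Kc U s" by (simp add: B_def mult.assoc)
  qed
  \<comment> \<open>Taking logarithms of \<open>a 2^-K <= t <= B 2^-K\<close> places
    \<open>K + log t\<close> between \<open>log a\<close> and \<open>log B\<close>, whose signs are
    unknown; hence the sum of absolute values. The factor \<open>min a (1 / B)\<close> serves both
    multiplicative bounds.\<close>
  have "\<bar>real (Kc U s) + log 2 (Re (mtrace (\<rho> * M s)))\<bar> \<le> \<bar>log 2 a\<bar> + \<bar>log 2 B\<bar> \<and>
           min a (1 / B) * Pc U s \<le> Re (mtrace (\<rho> * M s)) \<and>
           min a (1 / B) * Re (mtrace (\<rho> * M s)) \<le> Pc U s" if \<rho>: "density_matrix N \<rho>" for \<rho> s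
  proof -
    define t where "t = Re (mtrace (\<rho> * M s))"
    define h where "h = (1 / 2 :: real) ^ Kc U s"
    have h: "0 < h" "h \<le> Pc U s" using Kc_le_Pc[OF assms(2)] by (auto simp: h_def)
    have lo: "a * Pc U s \<le> t" and hi: "t \<le> B * h" using bounds[OF \<rho>] by (auto simp: t_def h_def)
    have "a * h \<le> a * Pc U s" using h a(1) by simp
    then have lo': "a * h \<le> t" using lo by linarith
    \<comment> \<open>Strict positivity of the trace is what makes its logarithm meaningful. It
      comes from the lower bound, as \<open>h\<close> is a power of one half.\<close>
    have t: "0 < t" using lo' mult_pos_pos[OF a(1) h(1)] by linarith
    have logh: "log 2 h = - real (Kc U s)" by (simp add: h_def log_nat_power log_divide)
    have "log 2 (a * h) \<le> log 2 t" using lo' a(1) h(1) t by simp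
    moreover have "log 2 t \<le> log 2 (B * h)" using hi B h(1) t by simp
    ultimately have "\<bar>real (Kc U s) + log 2 t\<bar> \<le> \<bar>log 2 a\<bar> + \<bar>log 2 B\<bar>"
      using a(1) B h(1) logh by (simp add: log_mult)
    moreover have "min a (1 / B) * Pc U s \<le> a * Pc U s"
      by (intro mult_right_mono Pc_nonneg) simp
    then have "min a (1 / B) * Pc U s \<le> t" using lo by linarith
    moreover have "min a (1 / B) * t \<le> 1 / B * t" using t by (intro mult_right_mono) auto
    moreover have "1 / B * t \<le> h" using hi B by (simp add: field_simps)
    then have "min a (1 / B) * t \<le> Pc U s" using calculation(3) h(2) by linarith
    ultimately show ?thesis unfolding t_def by blast
  qed
  moreover have "0 < min a (1 / B)" using a(1) B by simp
  moreover have "0 \<le> \<bar>log 2 a\<bar> + \<bar>log 2 B\<bar>" by simp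
  ultimately show ?thesis by blast
qed

end
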